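(* Let $(F_1,\dots,F_N)$ be a non-degenerate iterated function system of surjective maps on a complete metric space $(T,d)$, let $X=\{1,\dots,N\}^\infty$ with shift map $\sigma$, let $\mathcal{G}=\mathcal{G}(X,\sigma)$ be the Renault–Deaconu groupoid of $\sigma$, and let $L$ be the associated fractafold bundle with its canonical left $\mathcal{G}$-action. Let $\tilde\sigma:L\to L$ be the local homeomorphism $\tilde\sigma(x,t)=(\sigma(x),F_{x_1}(t))$. Then the left action groupoid $\mathcal{G}*L$ is isomorphic, as a topological groupoid, to the Renault–Deaconu groupoid $\tilde{\mathcal{G}}=\mathcal{G}(L,\tilde\sigma)$ associated to $\tilde\sigma$.
   Context: Iterated function system: $(T,d)$ is a complete metric space and $F_1,\dots,F_N:T\to T$ are maps for which there are constants $0<r_i\le R_i<1$ with $r_i d(t,t')\le d(F_i(t),F_i(t'))\le R_i d(t,t')$ for all $t,t'\in T$ (non-degeneracy); each $F_i$ is surjective, hence a homeomorphism. $K\subset T$ is the unique (non-empty) compact set with $K=F_1(K)\cup\dots\cup F_N(K)$. Words: $W=\{1,\dots,N\}$, $W^*=\bigcup_{n\in\mathbb{N}}W^n$, and $X=W^\infty$ is the space of infinite sequences with the topology generated by the cylinders $Z(\omega)=\{x\in X:x_i=\omega_i,\ i=1,\dots,|\omega|\}$, $\omega\in W^*$. The shift $\sigma(x_1x_2x_3\cdots)=x_2x_3\cdots$ is a local homeomorphism of $X$. For $\omega\in W^n$, $F_\omega=F_{\omega_n}\circ\dots\circ F_{\omega_1}$ and $F_\omega^{-1}=F_{\omega_1}^{-1}\circ\dots\circ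 F_{\omega_n}^{-1}$. $x(k)=x_1\cdots x_k$. Fractafold bundle: for $\omega\in W^n$ put $L_n(\omega)=F_\omega^{-1}(K)$; for $n\ge0$ let $L_n=\bigsqcup_{\omega\in W^n}Z(\omega)\times L_n(\omega)\subset X\times T$ with the subspace topology. Then $L_n\subset L_{n+1}$, and $L=\bigcup_{n\ge0}L_n$ with the inductive limit topology: $U\subset L$ is open iff $U\cap L_n$ is open in $L_n$ for every $n\ge0$. Renault–Deaconu groupoid: for a local homeomorphism $\tau:Y\to Y$ of a Hausdorff space $Y$, $$\mathcal{G}(Y,\tau)=\{(x,m-n,y)\in Y\times\mathbb{Z}\times Y:\ m,n\ge 0,\ \tau^m(x)=\tau^n(y)\},$$ with $(x,m,y)(y,n,w)=(x,m+n,w)$, $(x,n,y)^{-1}=(y,-n,x)$, $r(x,n,y)=x$, $s(x,n,y)=y$ (unit space identified with $Y$ via $(x,0,x)\mapsto x$). A basis for the topology consists of the sets $\{(x,m-n,y):\tau^m(x)=\tau^n(y),\ x\in U,\ y\in V\}$, where $m,n\in\mathbb{N}$, $U,V\subset Y$ are open, $\tau^m|_U$ and $\tau^n|_V$ are injective, and $\tau^m(U)=\tau^n(V)$. Canonical action and action groupoid: $\mathcal{G}$ acts on $L$ by $(x,m-n,y)\cdot(y,t)=(x,F_{x(m)}^{-1}\circ F_{y(n)}(t))$ (with $\sigma^m(x)=\sigma^n(y)$). The action groupoid is $\mathcal{G}*L=\{((x,m-n,y),(y,t)):(x,m-n,y)\in\mathcal{G},(y,t)\in L\}$ with the topology inherited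 from $\mathcal{G}\times L$; $(\gamma_1,z_1)$, $(\gamma_2,z_2)$ are composable iff $z_1=\gamma_2\cdot z_2$, with product $(\gamma_1\gamma_2,z_2)$ and inverse $(\gamma,z)^{-1}=(\gamma^{-1},\gamma\cdot z)$. *)

theory Defs
  imports "HOL-Analysis.Analysis" "HOL-Library.Stream"
begin

section \<open>Topological groupoids\<close>

text \<open>The unit space enters only through the range and source maps, which take
  values in a type of units \<open>'u\<close>; an arrow \<open>g\<close> can be composed with \<open>h\<close> (to form \<open>g h\<close>)
  iff the source of \<open>g\<close> is the range of \<open>h\<close>.\<close>

record ('g, 'u) groupoid =
  arrow_space :: "'g topology"
  range_map :: "'g \<Rightarrow> 'u"
  source_map :: "'g \<Rightarrow> 'u"
  mult :: "'g \<Rightarrow> 'g \<Rightarrow> 'g"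
  inverse_map :: "'g \<Rightarrow> 'g"

abbreviation arrows :: "('g, 'u) groupoid \<Rightarrow> 'g set" where
  "arrows G \<equiv> topspace (arrow_space G)"

definition composable :: "('g, 'u) groupoid \<Rightarrow> 'g \<Rightarrow> 'g \<Rightarrow> bool" where
  "composable G g h \<longleftrightarrow> g \<in> arrows G \<and> h \<in> arrows G \<and> source_map G g = range_map G h"

definition topological_groupoid_iso ::
    "('g, 'u) groupoid \<Rightarrow> ('h, 'v) groupoid \<Rightarrow> ('g \<Rightarrow> 'h) \<Rightarrow> bool" where
  "topological_groupoid_iso G H \<phi> \<longleftrightarrow>
     homeomorphic_map (arrow_space G) (arrow_space H) \<phi> \<and>
     (\<forall>g\<in>arrows G. \<forall>h\<in>arrows G. composable G g h \<longleftrightarrow> composable H (\<phi> g) (\<phi> h)) \<and>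
     (\<forall>g h. composable G g h \<longrightarrow> \<phi> (mult G g h) = mult H (\<phi> g) (\<phi> h)) \<and>
     (\<forall>g\<in>arrows G. \<phi> (inverse_map G g) = inverse_map H (\<phi> g))"

definition topological_groupoid_isomorphic ::
    "('g, 'u) groupoid \<Rightarrow> ('h, 'v) groupoid \<Rightarrow> bool" where
  "topological_groupoid_isomorphic G H \<longleftrightarrow> (\<exists>\<phi>. topological_groupoid_iso G H \<phi>)"

definition local_homeomorphism :: "'a topology \<Rightarrow> 'b topology \<Rightarrow> ('a \<Rightarrow> 'b) \<Rightarrow> bool" where
  "local_homeomorphism X Y f \<longleftrightarrow>
     (\<forall>x\<in>topspace X. \<exists>U. openin X U \<and> x \<in> U \<and> openin Y (f ` U) \<and>
        homeomorphic_map (subtopology X U) (subtopology Y (f ` U)) f)"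


section \<open>The Renault--Deaconu groupoid\<close>

definition rd_arrows :: "'y topology \<Rightarrow> ('y \<Rightarrow> 'y) \<Rightarrow> ('y \<times> int \<times> 'y) set" where
  "rd_arrows Y \<tau> =
     {(x, int m - int n, y) | x m n y.
        x \<in> topspace Y \<and> y \<in> topspace Y \<and> (\<tau> ^^ m) x = (\<tau> ^^ n) y}"

definition rd_basic :: "('y \<Rightarrow> 'y) \<Rightarrow> nat \<Rightarrow> nat \<Rightarrow> 'y set \<Rightarrow> 'y set \<Rightarrow> ('y \<times> int \<times> 'y) set" where
  "rd_basic \<tau> m n U V =
     {(x, int m - int n, y) | x y. (\<tau> ^^ m) x = (\<tau> ^^ n) y \<and> x \<in> U \<and> y \<in> V}"

text \<open>If \<open>\<tau>\<close> is a local homeomorphism, the sets below form a basis of the generated topology,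
  whose underlying set is \<^const>\<open>rd_arrows\<close> (lemma \<open>topspace_rd_topology\<close>).\<close>

definition rd_topology :: "'y topology \<Rightarrow> ('y \<Rightarrow> 'y) \<Rightarrow> ('y \<times> int \<times> 'y) topology" where
  "rd_topology Y \<tau> = topology_generated_by
     {rd_basic \<tau> m n U V | m n U V.
        openin Y U \<and> openin Y V \<and> inj_on (\<tau> ^^ m) U \<and> inj_on (\<tau> ^^ n) V \<and>
        (\<tau> ^^ m) ` U = (\<tau> ^^ n) ` V}"

definition renault_deaconu :: "'y topology \<Rightarrow> ('y \<Rightarrow> 'y) \<Rightarrow> ('y \<times> int \<times> 'y, 'y) groupoid" where
  "renault_deaconu Y \<tau> =
     \<lparr> arrow_space = rd_topology Y \<tau>,
       range_map = (\<lambda>(x, k, y). x),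
       source_map = (\<lambda>(x, k, y). y),
       mult = (\<lambda>(x, k, y) (y', l, w). (x, k + l, w)),
       inverse_map = (\<lambda>(x, k, y). (y, - k, x)) \<rparr>"


section \<open>Action groupoids\<close>

text \<open>\<open>G\<close> acts on \<open>Z\<close> from the left along the anchor map \<open>p\<close>: \<open>act \<gamma> z\<close> is meaningful when
  the source of \<open>\<gamma>\<close> is \<open>p z\<close>. The choice of range and source makes \<open>(\<gamma>, z)\<close>, \<open>(\<gamma>', z')\<close>
  composable iff \<open>z = act \<gamma>' z'\<close>.\<close>

definition action_groupoid ::
    "('g, 'u) groupoid \<Rightarrow> 'z topology \<Rightarrow> ('z \<Rightarrow> 'u) \<Rightarrow> ('g \<Rightarrow> 'z \<Rightarrow> 'z) \<Rightarrow> ('g \<times> 'z, 'z) groupoid" where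
  "action_groupoid G Z p act =
     \<lparr> arrow_space = subtopology (prod_topology (arrow_space G) Z)
         {(\<gamma>, z). \<gamma> \<in> arrows G \<and> z \<in> topspace Z \<and> source_map G \<gamma> = p z},
       range_map = (\<lambda>(\<gamma>, z). act \<gamma> z),
       source_map = (\<lambda>(\<gamma>, z). z),
       mult = (\<lambda>(\<gamma>, z) (\<gamma>', z'). (mult G \<gamma> \<gamma>', z')),
       inverse_map = (\<lambda>(\<gamma>, z). (inverse_map G \<gamma>, act \<gamma> z)) \<rparr>"


section \<open>Iterated function systems\<close>

definition nondegenerate_ifs :: "nat \<Rightarrow> (nat \<Rightarrow> 'a::metric_space \<Rightarrow> 'a) \<Rightarrow> bool" where
  "nondegenerate_ifs N F \<longleftrightarrow> 1 \<le> N \<and>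
     (\<forall>i\<in>{1..N}. \<exists>r R. 0 < r \<and> r \<le> R \<and> R < 1 \<and>
        (\<forall>t t'. r * dist t t' \<le> dist (F i t) (F i t') \<and> dist (F i t) (F i t') \<le> R * dist t t'))"

definition attractor :: "nat \<Rightarrow> (nat \<Rightarrow> 'a::metric_space \<Rightarrow> 'a) \<Rightarrow> 'a set" where
  "attractor N F = (THE K. K \<noteq> {} \<and> compact K \<and> K = (\<Union>i\<in>{1..N}. F i ` K))"

text \<open>The sequence \<open>x\<^sub>1 x\<^sub>2 \<dots>\<close> is the stream with head \<open>x\<^sub>1\<close>; the shift is \<^const>\<open>stl\<close> and the prefix
  \<open>x(k)\<close> is \<^term>\<open>stake k x\<close>. Words are lists over \<open>{1..N}\<close> and \<open>\<^const>\<open>fold\<close> F [i\<^sub>1, \<dots>, i\<^sub>n] = F i\<^sub>n \<circ> \<dots> \<circ> F i\<^sub>1\<close>.\<close>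

abbreviation word_map :: "(nat \<Rightarrow> 'a \<Rightarrow> 'a) \<Rightarrow> nat list \<Rightarrow> 'a \<Rightarrow> 'a" where
  "word_map F \<omega> \<equiv> fold F \<omega>"

definition cylinder :: "nat \<Rightarrow> nat list \<Rightarrow> nat stream set" where
  "cylinder N \<omega> = {x \<in> streams {1..N}. stake (length \<omega>) x = \<omega>}"

definition sequence_space :: "nat \<Rightarrow> nat stream topology" where
  "sequence_space N = topology_generated_by {cylinder N \<omega> | \<omega>. \<omega> \<in> lists {1..N}}"


section \<open>The fractafold bundle\<close>

definition bundle_level ::
    "nat \<Rightarrow> (nat \<Rightarrow> 'a::metric_space \<Rightarrow> 'a) \<Rightarrow> nat \<Rightarrow> (nat stream \<times> 'a) set" where
  "bundle_level N F n =
     (\<Union>\<omega>\<in>{\<omega> \<in> lists {1..N}. length \<omega> = n}. cylinder N \<omega> \<times> (word_map F \<omega> -` attractor N F))"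

definition bundle_level_topology ::
    "nat \<Rightarrow> (nat \<Rightarrow> 'a::metric_space \<Rightarrow> 'a) \<Rightarrow> nat \<Rightarrow> (nat stream \<times> 'a) topology" where
  "bundle_level_topology N F n =
     subtopology (prod_topology (sequence_space N) euclidean) (bundle_level N F n)"

definition fractafold_bundle ::
    "nat \<Rightarrow> (nat \<Rightarrow> 'a::metric_space \<Rightarrow> 'a) \<Rightarrow> (nat stream \<times> 'a) topology" where
  "fractafold_bundle N F = topology (\<lambda>U. U \<subseteq> (\<Union>n. bundle_level N F n) \<and>
     (\<forall>n. openin (bundle_level_topology N F n) (U \<inter> bundle_level N F n)))"

definition lifted_shift ::
    "(nat \<Rightarrow> 'a \<Rightarrow> 'a) \<Rightarrow> nat stream \<times> 'a \<Rightarrow> nat stream \<times> 'a" where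
  "lifted_shift F = (\<lambda>(x, t). (stl x, F (shd x) t))"

text \<open>The value does not depend on the choice of \<open>m, n\<close> with \<open>k = m - n\<close> (lemma
  \<open>canonical_action_eq\<close>).\<close>

definition canonical_action ::
    "(nat \<Rightarrow> 'a \<Rightarrow> 'a) \<Rightarrow> nat stream \<times> int \<times> nat stream \<Rightarrow> nat stream \<times> 'a \<Rightarrow> nat stream \<times> 'a" where
  "canonical_action F = (\<lambda>(x, k, y) (y', t).
     (x, THE u. \<exists>m n. k = int m - int n \<and> (stl ^^ m) x = (stl ^^ n) y \<and>
           u = inv (word_map F (stake m x)) (word_map F (stake n y) t)))"


section \<open>Well-definedness\<close>

subsection \<open>Existence and uniqueness of the attractor\<close>

lemma nondegenerate_ifs_uniform:
  assumes "nondegenerate_ifs N F"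
  obtains R where "0 < R" "R < 1" "\<And>i t t'. i \<in> {1..N} \<Longrightarrow> dist (F i t) (F i t') \<le> R * dist t t'"
proof -
  have "\<forall>i\<in>{1..N}. \<exists>R. 0 < R \<and> R < 1 \<and> (\<forall>t t'. dist (F i t) (F i t') \<le> R * dist t t')"
    using assms unfolding nondegenerate_ifs_def by (meson less_le_trans)
  then obtain r where r: "\<And>i. i \<in> {1..N} \<Longrightarrow> 0 < r i \<and> r i < 1 \<and>
      (\<forall>t t'. dist (F i t) (F i t') \<le> r i * dist t t')"
    by metis
  have ne: "finite (r ` {1..N})" "r ` {1..N} \<noteq> {}"
    using assms by (auto simp: nondegenerate_ifs_def)
  define R where "R = Max (r ` {1..N})"
  have le: "r i \<le> R" if "i \<in> {1..N}" for i
    using that by (simp add: R_def)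
  have "R \<in> r ` {1..N}"
    unfolding R_def using ne by (rule Max_in)
  then have "0 < R" "R < 1" using r by auto
  moreover have "dist (F i t) (F i t') \<le> R * dist t t'" if "i \<in> {1..N}" for i t t'
    using r[OF that] le[OF that] by (meson mult_right_mono order_trans zero_le_dist)
  ultimately show ?thesis using that by blast
qed

lemma continuous_on_ifs:
  assumes "nondegenerate_ifs N F" "i \<in> {1..N}"
  shows "continuous_on A (F i)"
proof -
  obtain R where R: "0 < R" "\<And>i t t'. i \<in> {1..N} \<Longrightarrow> dist (F i t) (F i t') \<le> R * dist t t'"
    using nondegenerate_ifs_uniform[OF assms(1)] by metis
  have "R-lipschitz_on A (F i)"
    using R assms(2) by (auto intro!: lipschitz_onI)
  then show ?thesis by (rule lipschitz_on_continuous_on)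
qed

lemma attractor_subset:
  assumes ifs: "nondegenerate_ifs N F"
    and K: "compact K" "K \<subseteq> (\<Union>i\<in>{1..N}. F i ` K)"
    and K': "K' \<noteq> {}" "compact K'" "(\<Union>i\<in>{1..N}. F i ` K') \<subseteq> K'"
  shows "K \<subseteq> K'"
proof (cases "K = {}")
  case False
  obtain R where R: "0 < R" "R < 1" "\<And>i t t'. i \<in> {1..N} \<Longrightarrow> dist (F i t) (F i t') \<le> R * dist t t'"
    using nondegenerate_ifs_uniform[OF ifs] by metis
  have "continuous_on K (\<lambda>t. infdist t K')"
    by (intro continuous_intros)
  then obtain t where t: "t \<in> K" and max: "\<And>s. s \<in> K \<Longrightarrow> infdist s K' \<le> infdist t K'"
    using continuous_attains_sup[OF K(1) False] by blast
  obtain i s where i_s: "i \<in> {1..N}" "s \<in> K" "t = F i s"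
    using t K(2) by blast
  have cont: "continuous_on K' (dist s)"
    by (intro continuous_intros)
  obtain k where k: "k \<in> K'" "\<And>k'. k' \<in> K' \<Longrightarrow> dist s k \<le> dist s k'"
    using continuous_attains_inf[OF K'(2,1) cont] by blast
  have "infdist s K' = dist s k"
    unfolding infdist_def using k K'(1)
    by (auto intro!: cInf_eq_minimum)
  moreover have "infdist t K' \<le> dist (F i s) (F i k)"
    using subsetD[OF K'(3) UN_I[OF i_s(1) imageI[OF k(1)]]] i_s(3) infdist_le by metis
  ultimately have "infdist t K' \<le> R * infdist s K'"
    using R(3)[OF i_s(1), of s k] by simp
  also have "\<dots> \<le> R * infdist t K'"
    using R(1) max[OF i_s(2)] by simp
  finally have "(1 - R) * infdist t K' \<le> 0"
    by (simp add: algebra_simps)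
  then have "infdist t K' \<le> 0"
    using R(2) by (simp add: mult_le_0_iff)
  then have "infdist s K' = 0" if "s \<in> K" for s
    using max[OF that] infdist_nonneg[of s K'] by linarith
  then show ?thesis
    using in_closed_iff_infdist_zero[OF compact_imp_closed[OF K'(2)] K'(1)] by blast
qed simp

lemma attractor_exists:
  fixes F :: "nat \<Rightarrow> 'a::complete_space \<Rightarrow> 'a"
  assumes ifs: "nondegenerate_ifs N F"
  shows "\<exists>K. K \<noteq> {} \<and> compact K \<and> K = (\<Union>i\<in>{1..N}. F i ` K)"
proof -
  obtain R where R: "0 < R" "R < 1" "\<And>i t t'. i \<in> {1..N} \<Longrightarrow> dist (F i t) (F i t') \<le> R * dist t t'"
    using nondegenerate_ifs_uniform[OF ifs] by metis
  have one: "1 \<in> {1..N}" using ifs by (simp add: nondegenerate_ifs_def)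
  have "\<exists>!p. F 1 p = p"
    using banach_fix_type[of R "F 1"] R one by auto
  then obtain p where p: "F 1 p = p" by blast
  define S where "S = {fold F \<omega> p | \<omega>. \<omega> \<in> lists {1..N}}"
  have pS: "p \<in> S" unfolding S_def by (auto intro!: exI[of _ "[]"])
  have FS: "F i s \<in> S" if i: "i \<in> {1..N}" and s: "s \<in> S" for i s
  proof -
    obtain \<omega> where "\<omega> \<in> lists {1..N}" "s = fold F \<omega> p" using s S_def by auto
    then have "F i s = fold F (\<omega> @ [i]) p" "\<omega> @ [i] \<in> lists {1..N}" using i by auto
    then show ?thesis unfolding S_def by blast
  qed
  have SF: "\<exists>i\<in>{1..N}. \<exists>s'\<in>S. s = F i s'" if s: "s \<in> S" for s
  proof -
    obtain \<omega> where w: "\<omega> \<in> lists {1..N}" "s = fold F \<omega> p" using s S_def by auto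
    show ?thesis
    proof (cases \<omega> rule: rev_cases)
      case Nil
      then show ?thesis using w p pS one by (auto intro!: bexI[of _ 1] bexI[of _ p])
    next
      case (snoc \<omega>' i)
      then show ?thesis using w by (auto simp: S_def intro!: bexI[of _ i])
    qed
  qed
  have S_eq: "S = (\<Union>i\<in>{1..N}. F i ` S)"
    using SF FS by blast
  define C where "C = (\<Sum>i\<in>{1..N}. dist p (F i p))"
  have C: "dist p (F i p) \<le> C" if "i \<in> {1..N}" for i
    unfolding C_def using that by (intro member_le_sum) auto
  define D where "D = C / (1 - R)"
  have DC: "C + R * D = D" using R(2) by (simp add: D_def field_simps)
  have bd: "dist p (fold F \<omega> p) \<le> D" if "\<omega> \<in> lists {1..N}" for \<omega>
    using that
  proof (induction \<omega> rule: rev_induct)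
    case Nil
    have "0 \<le> C" unfolding C_def by (intro sum_nonneg) auto
    then show ?case using R(2) by (simp add: D_def)
  next
    case (snoc i \<omega>)
    have i: "i \<in> {1..N}" and w: "\<omega> \<in> lists {1..N}" using snoc.prems by auto
    have "dist p (F i (fold F \<omega> p)) \<le> dist p (F i p) + dist (F i p) (F i (fold F \<omega> p))"
      by (rule dist_triangle)
    also have "\<dots> \<le> C + R * dist p (fold F \<omega> p)"
      using C[OF i] R(3)[OF i] by (intro add_mono) auto
    also have "\<dots> \<le> C + R * D"
      using snoc.IH[OF w] R(1) by simp
    finally show ?case using DC by simp
  qed
  have tb: "\<exists>k. finite k \<and> S \<subseteq> (\<Union>x\<in>k. cball x (R ^ n * D))" for n
  proof (induction n)
    case 0
    have "S \<subseteq> cball p D" unfolding S_def using bd by fastforce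
    then show ?case by (intro exI[of _ "{p}"]) auto
  next
    case (Suc n)
    then obtain k where k: "finite k" "S \<subseteq> (\<Union>x\<in>k. cball x (R ^ n * D))" by blast
    have "s \<in> (\<Union>x\<in>(\<Union>i\<in>{1..N}. F i ` k). cball x (R ^ Suc n * D))" if "s \<in> S" for s
    proof -
      obtain i s' where i: "i \<in> {1..N}" "s' \<in> S" "s = F i s'" using SF[OF \<open>s \<in> S\<close>] by blast
      obtain x where x: "x \<in> k" "dist x s' \<le> R ^ n * D" using k(2) i(2) by auto
      have "dist (F i x) s \<le> R * dist x s'" using R(3)[OF i(1)] i(3) by simp
      also have "\<dots> \<le> R ^ Suc n * D" using x(2) R(1) by simp
      finally show ?thesis using i(1) x(1) by auto
    qed
    then show ?case
      using k(1) by (intro exI[of _ "\<Union>i\<in>{1..N}. F i ` k"]) auto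
  qed
  have "compact (closure S)"
    unfolding compact_eq_totally_bounded
  proof (intro conjI allI impI)
    show "complete (closure S)" by (simp add: complete_eq_closed)
    fix e :: real assume "0 < e"
    have "(\<lambda>n. R ^ n * D) \<longlonglongrightarrow> 0 * D"
      using R(1,2) by (intro tendsto_mult LIMSEQ_realpow_zero tendsto_const) auto
    then have "eventually (\<lambda>n. R ^ n * D < e) sequentially"
      using \<open>0 < e\<close> by (auto dest!: order_tendstoD(2)[where a = e])
    then obtain n where n: "R ^ n * D < e"
      by (auto simp: eventually_sequentially)
    obtain k where k: "finite k" "S \<subseteq> (\<Union>x\<in>k. cball x (R ^ n * D))" using tb by blast
    have "closure S \<subseteq> (\<Union>x\<in>k. cball x (R ^ n * D))"
      using k by (intro closure_minimal closed_UN) auto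
    also have "\<dots> \<subseteq> (\<Union>x\<in>k. ball x e)" using n by (auto intro: order_le_less_trans)
    finally show "\<exists>k. finite k \<and> closure S \<subseteq> (\<Union>x\<in>k. ball x e)" using k(1) by blast
  qed
  moreover have "closure S = (\<Union>i\<in>{1..N}. F i ` closure S)"
  proof
    have "closed (\<Union>i\<in>{1..N}. F i ` closure S)"
      using \<open>compact (closure S)\<close> continuous_on_ifs[OF ifs]
      by (intro closed_UN) (auto intro!: compact_imp_closed compact_continuous_image)
    moreover have "S \<subseteq> (\<Union>i\<in>{1..N}. F i ` closure S)"
      using SF closure_subset[of S] by fast
    ultimately show "closure S \<subseteq> (\<Union>i\<in>{1..N}. F i ` closure S)"
      by (simp add: closure_minimal)
    have "F i ` closure S \<subseteq> closure S" if "i \<in> {1..N}" for i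
      using continuous_on_ifs[OF ifs that] FS[OF that] closure_subset[of S]
      by (intro image_closure_subset) auto
    then show "(\<Union>i\<in>{1..N}. F i ` closure S) \<subseteq> closure S" by blast
  qed
  moreover have "closure S \<noteq> {}" using pS closure_subset[of S] by blast
  ultimately show ?thesis by blast
qed

lemma attractor_ex1:
  fixes F :: "nat \<Rightarrow> 'a::complete_space \<Rightarrow> 'a"
  assumes "nondegenerate_ifs N F"
  shows "\<exists>!K. K \<noteq> {} \<and> compact K \<and> K = (\<Union>i\<in>{1..N}. F i ` K)"
proof (rule ex_ex1I[OF attractor_exists[OF assms]])
  fix K K' assume "K \<noteq> {} \<and> compact K \<and> K = (\<Union>i\<in>{1..N}. F i ` K)"
    and "K' \<noteq> {} \<and> compact K' \<and> K' = (\<Union>i\<in>{1..N}. F i ` K')"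
  then show "K = K'"
    using attractor_subset[OF assms, of K K'] attractor_subset[OF assms, of K' K] by blast
qed

lemma
  fixes F :: "nat \<Rightarrow> 'a::complete_space \<Rightarrow> 'a"
  assumes "nondegenerate_ifs N F"
  shows attractor_nonempty: "attractor N F \<noteq> {}"
    and compact_attractor: "compact (attractor N F)"
    and attractor_eq: "attractor N F = (\<Union>i\<in>{1..N}. F i ` attractor N F)"
  using theI'[OF attractor_ex1[OF assms]] unfolding attractor_def by blast+



subsection \<open>Words and the canonical action\<close>

lemma stake_in_lists: "x \<in> streams A \<Longrightarrow> stake n x \<in> lists A"
  by (induction n arbitrary: x) (auto simp: streams_shd streams_stl)

lemma sdrop_in_streams: "x \<in> streams A \<Longrightarrow> sdrop n x \<in> streams A"
  by (induction n arbitrary: x) (auto simp: streams_stl)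

lemma funpow_stl: "(stl ^^ n) x = sdrop n x"
  by (induction n arbitrary: x) (auto simp: funpow_swap1 simp flip: sdrop_stl)

lemma inj_ifs:
  assumes "nondegenerate_ifs N F" "i \<in> {1..N}"
  shows "inj (F i)"
proof (rule injI)
  fix t t' assume eq: "F i t = F i t'"
  obtain r where "0 < r" "\<And>t t'. r * dist t t' \<le> dist (F i t) (F i t')"
    using assms unfolding nondegenerate_ifs_def by metis
  then have "r * dist t t' \<le> 0" "0 < r" using eq by (metis dist_self)+
  then have "dist t t' \<le> 0" by (simp add: mult_le_0_iff)
  then show "t = t'" by simp
qed

lemma bij_word_map:
  assumes "nondegenerate_ifs N F" "\<forall>i\<in>{1..N}. surj (F i)" "\<omega> \<in> lists {1..N}"
  shows "bij (word_map F \<omega>)"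
  using assms(3)
proof (induction \<omega>)
  case (Cons i \<omega>)
  then have "bij (F i)" using inj_ifs[OF assms(1)] assms(2) by (auto simp: bij_def)
  moreover have "bij (word_map F \<omega>)" using Cons by simp
  ultimately have "bij (word_map F \<omega> \<circ> F i)" by (rule bij_comp)
  then show ?case by (simp add: comp_def)
qed (simp add: id_def[symmetric])

lemma canonical_action_value_extend:
  assumes ifs: "nondegenerate_ifs N F" "\<forall>i\<in>{1..N}. surj (F i)"
    and x: "x \<in> streams {1..N}" and y: "y \<in> streams {1..N}"
    and eq: "(stl ^^ m) x = (stl ^^ n) y"
  shows "inv (word_map F (stake (m + j) x)) (word_map F (stake (n + j) y) t) =
         inv (word_map F (stake m x)) (word_map F (stake n y) t)"
proof -
  define w where "w = stake j (sdrop m x)"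
  have wx: "stake (m + j) x = stake m x @ w" and wy: "stake (n + j) y = stake n y @ w"
    using eq stake_add[of m x j] stake_add[of n y j] unfolding w_def funpow_stl by metis+
  have bx: "bij (word_map F (stake m x))"
    by (intro bij_word_map[OF ifs] stake_in_lists x)
  have bw: "bij (word_map F w)" unfolding w_def
    by (intro bij_word_map[OF ifs] stake_in_lists sdrop_in_streams x)
  have "word_map F (stake (m + j) x) = word_map F w \<circ> word_map F (stake m x)"
    unfolding wx by (simp add: comp_def)
  then have "inv (word_map F (stake (m + j) x)) = inv (word_map F (stake m x)) \<circ> inv (word_map F w)"
    using o_inv_distrib[OF bw bx] by metis
  moreover have "inv (word_map F w) (word_map F w u) = u" for u
    using bw by (simp add: bij_is_inj)
  ultimately show ?thesis by (simp add: wy)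
qed

lemma canonical_action_eq:
  assumes ifs: "nondegenerate_ifs N F" "\<forall>i\<in>{1..N}. surj (F i)"
    and x: "x \<in> streams {1..N}" and y: "y \<in> streams {1..N}"
    and eq: "(stl ^^ m) x = (stl ^^ n) y"
  shows "canonical_action F (x, int m - int n, y) (y, t) =
         (x, inv (word_map F (stake m x)) (word_map F (stake n y) t))"
proof -
  let ?v = "\<lambda>m n. inv (word_map F (stake m x)) (word_map F (stake n y) t)"
  note ext = canonical_action_value_extend[OF ifs x y]
  have "u = ?v m n"
    if u: "\<exists>m' n'. int m - int n = int m' - int n' \<and> (stl ^^ m') x = (stl ^^ n') y \<and> u = ?v m' n'"
    for u
  proof -
    obtain m' n' where mn: "int m - int n = int m' - int n'" "(stl ^^ m') x = (stl ^^ n') y"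
      and uv: "u = ?v m' n'"
      using u by blast
    show ?thesis
    proof (cases "m \<le> m'")
      case True
      then have "m' = m + (m' - m)" "n' = n + (m' - m)" using mn(1) by linarith+
      then show ?thesis using ext[OF eq, of "m' - m" t] uv by metis
    next
      case False
      then have "m = m' + (m - m')" "n = n' + (m - m')" using mn(1) by linarith+
      then show ?thesis using ext[OF mn(2), of "m - m'" t] uv by metis
    qed
  qed
  then have "(THE u. \<exists>m' n'. int m - int n = int m' - int n' \<and> (stl ^^ m') x = (stl ^^ n') y \<and>
      u = ?v m' n') = ?v m n"
    using eq by (intro the_equality) blast+
  then show ?thesis by (simp add: canonical_action_def)
qed


subsection \<open>Topology of the bundle\<close>

lemma Union_cylinders: "\<Union>{cylinder N \<omega> | \<omega>. \<omega> \<in> lists {1..N}} = streams {1..N}"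
proof
  have "streams {1..N} = cylinder N []" by (simp add: cylinder_def)
  then show "streams {1..N} \<subseteq> \<Union>{cylinder N \<omega> | \<omega>. \<omega> \<in> lists {1..N}}" by blast
  show "\<Union>{cylinder N \<omega> | \<omega>. \<omega> \<in> lists {1..N}} \<subseteq> streams {1..N}"
    unfolding cylinder_def by blast
qed

lemma topspace_sequence_space [simp]: "topspace (sequence_space N) = streams {1..N}"
  unfolding sequence_space_def topology_generated_by_topspace by (rule Union_cylinders)

lemma openin_cylinder: "\<omega> \<in> lists {1..N} \<Longrightarrow> openin (sequence_space N) (cylinder N \<omega>)"
  unfolding sequence_space_def by (rule topology_generated_by_Basis) blast

lemma bundle_level_iff:
  "(x, t) \<in> bundle_level N F n \<longleftrightarrow>
     x \<in> streams {1..N} \<and> word_map F (stake n x) t \<in> attractor N F"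
  using stake_in_lists[of x "{1..N}" n] unfolding bundle_level_def cylinder_def by force

lemma bundle_level_mono:
  fixes F :: "nat \<Rightarrow> 'a::complete_space \<Rightarrow> 'a"
  assumes "nondegenerate_ifs N F"
  shows "bundle_level N F n \<subseteq> bundle_level N F (Suc n)"
proof
  fix p assume p: "p \<in> bundle_level N F n"
  obtain x t where xt: "p = (x, t)" by fastforce
  then have x: "x \<in> streams {1..N}" and "word_map F (stake n x) t \<in> attractor N F"
    using p by (auto simp: bundle_level_iff)
  moreover have "x !! n \<in> {1..N}" using snth_in[OF x] .
  ultimately have "F (x !! n) (word_map F (stake n x) t) \<in> attractor N F"
    using attractor_eq[OF assms] by blast
  then show "p \<in> bundle_level N F (Suc n)"
    using x by (simp add: xt bundle_level_iff stake_Suc del: stake.simps)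
qed

lemma openin_fractafold_bundle:
  "openin (fractafold_bundle N F) U \<longleftrightarrow> U \<subseteq> (\<Union>n. bundle_level N F n) \<and>
     (\<forall>n. openin (bundle_level_topology N F n) (U \<inter> bundle_level N F n))"
proof -
  have "istopology (\<lambda>U. U \<subseteq> (\<Union>n. bundle_level N F n) \<and>
     (\<forall>n. openin (bundle_level_topology N F n) (U \<inter> bundle_level N F n)))"
    unfolding istopology_def
  proof (intro conjI allI impI)
    fix S T n
    assume "S \<subseteq> (\<Union>n. bundle_level N F n) \<and>
        (\<forall>n. openin (bundle_level_topology N F n) (S \<inter> bundle_level N F n))"
      and "T \<subseteq> (\<Union>n. bundle_level N F n) \<and>
        (\<forall>n. openin (bundle_level_topology N F n) (T \<inter> bundle_level N F n))"
    then have "openin (bundle_level_topology N F n)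
        ((S \<inter> bundle_level N F n) \<inter> (T \<inter> bundle_level N F n))"
      by blast
    then show "openin (bundle_level_topology N F n) (S \<inter> T \<inter> bundle_level N F n)"
      by (simp add: Int_ac)
  next
    fix \<K> n
    assume "\<forall>K\<in>\<K>. K \<subseteq> (\<Union>n. bundle_level N F n) \<and>
        (\<forall>n. openin (bundle_level_topology N F n) (K \<inter> bundle_level N F n))"
    then have "openin (bundle_level_topology N F n) (\<Union>K\<in>\<K>. K \<inter> bundle_level N F n)"
      by (intro openin_Union) auto
    then show "openin (bundle_level_topology N F n) (\<Union> \<K> \<inter> bundle_level N F n)"
      by (simp only: Int_Union2)
  qed blast+
  then show ?thesis
    by (simp add: fractafold_bundle_def topology_inverse')
qed

lemma topspace_bundle_level_topology [simp]:
  "topspace (bundle_level_topology N F n) = bundle_level N F n"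
  by (auto simp: bundle_level_topology_def bundle_level_iff)

lemma topspace_fractafold_bundle: "topspace (fractafold_bundle N F) = (\<Union>n. bundle_level N F n)"
proof
  show "topspace (fractafold_bundle N F) \<subseteq> (\<Union>n. bundle_level N F n)"
    using openin_topspace openin_fractafold_bundle by blast
  have "(\<Union>n. bundle_level N F n) \<inter> bundle_level N F n = topspace (bundle_level_topology N F n)" for n
    by auto
  then have "openin (fractafold_bundle N F) (\<Union>n. bundle_level N F n)"
    unfolding openin_fractafold_bundle by (metis openin_topspace order_refl)
  then show "(\<Union>n. bundle_level N F n) \<subseteq> topspace (fractafold_bundle N F)"
    by (rule openin_subset)
qed


lemma openin_fractafold_bundle_Suc:
  fixes F :: "nat \<Rightarrow> 'a::complete_space \<Rightarrow> 'a"
  assumes ifs: "nondegenerate_ifs N F" and U: "U \<subseteq> topspace (fractafold_bundle N F)"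
    and op: "\<And>n. openin (bundle_level_topology N F (Suc n)) (U \<inter> bundle_level N F (Suc n))"
  shows "openin (fractafold_bundle N F) U"
  unfolding openin_fractafold_bundle
proof (intro conjI allI)
  show "U \<subseteq> (\<Union>n. bundle_level N F n)" using U by (simp add: topspace_fractafold_bundle)
  fix n
  obtain O' where O': "openin (prod_topology (sequence_space N) euclidean) O'"
    "U \<inter> bundle_level N F (Suc n) = O' \<inter> bundle_level N F (Suc n)"
    using op[of n] unfolding bundle_level_topology_def openin_subtopology by blast
  then have "U \<inter> bundle_level N F n = O' \<inter> bundle_level N F n"
    using bundle_level_mono[OF ifs, of n] by blast
  then show "openin (bundle_level_topology N F n) (U \<inter> bundle_level N F n)"
    using O'(1) unfolding bundle_level_topology_def openin_subtopology by blast
qed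

lemma Hausdorff_sequence_space: "Hausdorff_space (sequence_space N)"
  unfolding Hausdorff_space_def
proof (intro allI impI)
  fix x y assume xy: "x \<in> topspace (sequence_space N) \<and> y \<in> topspace (sequence_space N) \<and> x \<noteq> y"
  then obtain n where n: "x !! n \<noteq> y !! n" by (metis smap_alt stream.map_id0 id_apply)
  then have "stake (Suc n) x \<noteq> stake (Suc n) y" by (simp add: stake_Suc del: stake.simps)
  then have "cylinder N (stake (Suc n) x) \<inter> cylinder N (stake (Suc n) y) = {}"
    unfolding cylinder_def length_stake by (auto simp del: stake.simps)
  moreover have "openin (sequence_space N) (cylinder N (stake (Suc n) x))"
    "openin (sequence_space N) (cylinder N (stake (Suc n) y))"
    using xy by (auto intro!: openin_cylinder stake_in_lists simp del: stake.simps)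
  moreover have "x \<in> cylinder N (stake (Suc n) x)" "y \<in> cylinder N (stake (Suc n) y)"
    using xy unfolding cylinder_def length_stake by simp_all
  ultimately show "\<exists>U V. openin (sequence_space N) U \<and> openin (sequence_space N) V \<and>
      x \<in> U \<and> y \<in> V \<and> disjnt U V"
    unfolding disjnt_def by blast
qed

lemma Hausdorff_fractafold_bundle:
  fixes F :: "nat \<Rightarrow> 'a::metric_space \<Rightarrow> 'a"
  shows "Hausdorff_space (fractafold_bundle N F)"
proof -
  let ?P = "prod_topology (sequence_space N) (euclidean :: 'a topology)"
  have "Hausdorff_space ?P"
    by (simp add: Hausdorff_space_prod_topology Hausdorff_sequence_space)
  then have "Hausdorff_space (subtopology ?P (topspace (fractafold_bundle N F)))"
    by (rule Hausdorff_space_subtopology)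
  then show ?thesis
  proof (rule Hausdorff_space_expansive)
    have "topspace (fractafold_bundle N F) \<subseteq> topspace ?P"
      by (auto simp: topspace_fractafold_bundle bundle_level_iff)
    then show "topspace (subtopology ?P (topspace (fractafold_bundle N F))) =
        topspace (fractafold_bundle N F)"
      by (simp add: inf_absorb2)
    fix U assume "openin (subtopology ?P (topspace (fractafold_bundle N F))) U"
    then obtain O' where O': "openin ?P O'" "U = O' \<inter> (\<Union>n. bundle_level N F n)"
      unfolding openin_subtopology topspace_fractafold_bundle by blast
    then have "U \<inter> bundle_level N F n = O' \<inter> bundle_level N F n" for n by blast
    then show "openin (fractafold_bundle N F) U"
      unfolding openin_fractafold_bundle bundle_level_topology_def
      using O' by (auto simp: openin_subtopology)
  qed
qed

lemma continuous_map_stl: "continuous_map (sequence_space N) (sequence_space N) stl"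
  unfolding continuous_on_generated_topo_iff[where S = "{cylinder N \<omega> | \<omega>. \<omega> \<in> lists {1..N}}",
      folded sequence_space_def]
proof (intro conjI allI impI)
  fix U assume "U \<in> {cylinder N \<omega> | \<omega>. \<omega> \<in> lists {1..N}}"
  then obtain \<omega> where w: "\<omega> \<in> lists {1..N}" "U = cylinder N \<omega>" by blast
  have "stl -` U \<inter> topspace (sequence_space N) = (\<Union>i\<in>{1..N}. cylinder N (i # \<omega>))"
    using w(2) by (auto simp: cylinder_def streams_stl dest: streams_shd)
  moreover have "openin (sequence_space N) (\<Union>i\<in>{1..N}. cylinder N (i # \<omega>))"
    using w(1) by (intro openin_Union) (auto intro!: openin_cylinder)
  ultimately show "openin (sequence_space N) (stl -` U \<inter> topspace (sequence_space N))" by simp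
next
  show "stl ` topspace (sequence_space N) \<subseteq> \<Union> {cylinder N \<omega> | \<omega>. \<omega> \<in> lists {1..N}}"
    unfolding Union_cylinders topspace_sequence_space by (auto intro: streams_stl)
qed

lemma continuous_map_SCons:
  assumes i: "i \<in> {1..N}"
  shows "continuous_map (sequence_space N) (sequence_space N) (SCons i)"
  unfolding continuous_on_generated_topo_iff[where S = "{cylinder N \<omega> | \<omega>. \<omega> \<in> lists {1..N}}",
      folded sequence_space_def]
proof (intro conjI allI impI)
  fix U assume "U \<in> {cylinder N \<omega> | \<omega>. \<omega> \<in> lists {1..N}}"
  then obtain \<omega> where w: "\<omega> \<in> lists {1..N}" "U = cylinder N \<omega>" by blast
  show "openin (sequence_space N) (SCons i -` U \<inter> topspace (sequence_space N))"
  proof (cases \<omega>)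
    case Nil
    then have "SCons i -` U \<inter> topspace (sequence_space N) = topspace (sequence_space N)"
      using w(2) i by (auto simp: cylinder_def streams_Stream)
    then show ?thesis by (metis openin_topspace)
  next
    case (Cons j \<omega>')
    then have "SCons i -` U \<inter> topspace (sequence_space N) = (if i = j then cylinder N \<omega>' else {})"
      using w(2) i by (auto simp: cylinder_def streams_Stream)
    then show ?thesis using w(1) Cons by (auto intro: openin_cylinder)
  qed
next
  show "SCons i ` topspace (sequence_space N) \<subseteq> \<Union> {cylinder N \<omega> | \<omega>. \<omega> \<in> lists {1..N}}"
    unfolding Union_cylinders topspace_sequence_space using i by (auto simp: streams_Stream)
qed

lemma local_homeomorphism_shift: "local_homeomorphism (sequence_space N) (sequence_space N) stl"
  unfolding local_homeomorphism_def
proof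
  let ?X = "sequence_space N"
  fix x assume "x \<in> topspace ?X"
  then have x: "x \<in> streams {1..N}" by simp
  define i where "i = shd x"
  have i: "i \<in> {1..N}" using streams_shd[OF x] by (simp only: i_def)
  define U where "U = cylinder N [i]"
  have U: "U = {y \<in> streams {1..N}. shd y = i}" by (auto simp: U_def cylinder_def)
  have opU: "openin ?X U" unfolding U_def using i by (intro openin_cylinder) auto
  have "continuous_map (subtopology ?X U) ?X stl"
    by (rule continuous_map_from_subtopology[OF continuous_map_stl])
  moreover have "continuous_map ?X (subtopology ?X U) (SCons i)"
    using i by (intro continuous_map_into_subtopology continuous_map_SCons)
      (auto simp: U streams_Stream)
  ultimately have "homeomorphic_maps (subtopology ?X U) ?X stl (SCons i)"
    unfolding homeomorphic_maps_def by (auto simp: U)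
  then have hom: "homeomorphic_map (subtopology ?X U) ?X stl"
    by (rule homeomorphic_maps_imp_map)
  have "topspace (subtopology ?X U) = U" by (auto simp: U)
  then have "stl ` U = topspace ?X"
    using homeomorphic_imp_surjective_map[OF hom] by simp
  moreover have "x \<in> U" using x by (simp add: U i_def)
  ultimately show "\<exists>U. openin ?X U \<and> x \<in> U \<and> openin ?X (stl ` U) \<and>
      homeomorphic_map (subtopology ?X U) (subtopology ?X (stl ` U)) stl"
    using opU hom by (intro exI[of _ U]) (simp del: topspace_sequence_space)
qed

lemma continuous_on_inv_ifs:
  assumes ifs: "nondegenerate_ifs N F" "i \<in> {1..N}" and surj: "surj (F i)"
  shows "continuous_on A (inv (F i))"
proof -
  obtain r where r: "0 < r" "\<And>t t'. r * dist t t' \<le> dist (F i t) (F i t')"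
    using ifs unfolding nondegenerate_ifs_def by metis
  have "(1 / r)-lipschitz_on A (inv (F i))"
  proof (rule lipschitz_onI)
    fix s s'
    have "r * dist (inv (F i) s) (inv (F i) s') \<le> dist s s'"
      using r(2)[of "inv (F i) s" "inv (F i) s'"] surj by (simp add: surj_f_inv_f)
    then show "dist (inv (F i) s) (inv (F i) s') \<le> 1 / r * dist s s'"
      using r(1) by (simp add: field_simps)
  qed (use r(1) in simp)
  then show ?thesis by (rule lipschitz_on_continuous_on)
qed

lemma local_homeomorphism_lifted_shift:
  fixes F :: "nat \<Rightarrow> 'a::complete_space \<Rightarrow> 'a"
  assumes ifs: "nondegenerate_ifs N F" "\<forall>i\<in>{1..N}. surj (F i)"
  shows "local_homeomorphism (fractafold_bundle N F) (fractafold_bundle N F) (lifted_shift F)"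
  unfolding local_homeomorphism_def
proof
  let ?L = "fractafold_bundle N F" and ?\<sigma> = "lifted_shift F" and ?B = "bundle_level N F"
  let ?P = "prod_topology (sequence_space N) (euclidean :: 'a topology)"
  fix p assume p: "p \<in> topspace ?L"
  define i where "i = shd (fst p)"
  have i: "i \<in> {1..N}"
    using p streams_shd unfolding i_def topspace_fractafold_bundle
    by (cases p) (auto simp: bundle_level_iff simp del: atLeastAtMost_iff)
  define U where "U = {q \<in> topspace ?L. shd (fst q) = i}"
  define s where "s = (\<lambda>(x, t). (stl x, F i t) :: nat stream \<times> 'a)"
  define g where "g = (\<lambda>(y, t). (SCons i y, inv (F i) t) :: nat stream \<times> 'a)"
  have inj: "inv (F i) (F i t) = t" for t
    using inj_ifs[OF ifs(1) i] by simp
  have sur: "F i (inv (F i) t) = t" for t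
    using ifs(2) i by (simp add: surj_f_inv_f)
  have contP: "continuous_map ?P ?P s"
  proof -
    have "continuous_map ?P (sequence_space N) (stl \<circ> fst)"
      by (rule continuous_map_compose[OF continuous_map_fst continuous_map_stl])
    moreover have "continuous_map ?P euclidean (F i \<circ> snd)"
      using continuous_on_ifs[OF ifs(1) i] by (intro continuous_map_compose[OF continuous_map_snd]) auto
    ultimately show ?thesis
      by (simp add: continuous_map_pairwise s_def comp_def case_prod_beta)
  qed
  have contG: "continuous_map ?P ?P g"
  proof -
    have "continuous_map ?P (sequence_space N) (SCons i \<circ> fst)"
      by (rule continuous_map_compose[OF continuous_map_fst continuous_map_SCons[OF i]])
    moreover have "continuous_map ?P euclidean (inv (F i) \<circ> snd)"
      using continuous_on_inv_ifs[OF ifs(1) i] ifs(2) i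
      by (intro continuous_map_compose[OF continuous_map_snd]) auto
    ultimately show ?thesis
      by (simp add: continuous_map_pairwise g_def comp_def case_prod_beta)
  qed
  have Bsub: "?B n \<subseteq> topspace ?P" for n
    by (auto simp: bundle_level_iff)
  have BL: "?B n \<subseteq> topspace ?L" for n
    by (auto simp: topspace_fractafold_bundle)
  have sB: "s q \<in> ?B n" if "q \<in> ?B (Suc n)" "shd (fst q) = i" for q n
    using that by (cases q) (auto simp: s_def bundle_level_iff streams_stl)
  have gB: "g q \<in> ?B (Suc n)" "shd (fst (g q)) = i" "s (g q) = q" if "q \<in> ?B n" for q n
    using that i by (cases q; auto simp: g_def s_def bundle_level_iff streams_Stream sur)+
  have gs: "g (s q) = q" if "shd (fst q) = i" for q
    using that by (cases q) (auto simp: g_def s_def inj)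
  have \<sigma>s: "?\<sigma> q = s q" if "q \<in> U" for q
    using that by (cases q) (auto simp: lifted_shift_def s_def U_def)
  have UB: "\<exists>n. q \<in> ?B (Suc n)" if "q \<in> topspace ?L" for q
    using that bundle_level_mono[OF ifs(1)] unfolding topspace_fractafold_bundle by blast
  have sL: "s q \<in> topspace ?L" if "q \<in> U" for q
    using UB[of q] that sB BL unfolding U_def by blast
  have gU: "g q \<in> U" "s (g q) = q" if "q \<in> topspace ?L" for q
    using that gB BL unfolding U_def topspace_fractafold_bundle by blast+
  have opU: "openin ?L U"
  proof -
    have O': "openin ?P (cylinder N [i] \<times> UNIV)"
      using openin_cylinder[of "[i]" N] i by (simp add: openin_prod_Times_iff)
    have "U \<inter> ?B n = (cylinder N [i] \<times> UNIV) \<inter> ?B n" for n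
      using BL by (force simp: U_def cylinder_def bundle_level_iff)
    then show ?thesis unfolding openin_fractafold_bundle bundle_level_topology_def
      using O' by (auto simp: openin_subtopology U_def topspace_fractafold_bundle)
  qed
  have "continuous_map (subtopology ?L U) ?L s"
    unfolding continuous_map
  proof (intro conjI allI impI)
    show "s ` topspace (subtopology ?L U) \<subseteq> topspace ?L" using sL by auto
    fix W assume W: "openin ?L W"
    have "openin ?L {q \<in> U. s q \<in> W}"
    proof (rule openin_fractafold_bundle_Suc[OF ifs(1)])
      show "{q \<in> U. s q \<in> W} \<subseteq> topspace ?L" by (auto simp: U_def)
      fix n
      obtain O' where O': "openin ?P O'" "W \<inter> ?B n = O' \<inter> ?B n"
        using W unfolding openin_fractafold_bundle bundle_level_topology_def openin_subtopology by blast
      obtain V where V: "openin ?P V" "U \<inter> ?B (Suc n) = V \<inter> ?B (Suc n)"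
        using opU unfolding openin_fractafold_bundle bundle_level_topology_def openin_subtopology by blast
      have "s q \<in> W \<longleftrightarrow> s q \<in> O'" if "q \<in> U" "q \<in> ?B (Suc n)" for q
        using sB[OF that(2)] that(1) O'(2) unfolding U_def by blast
      then have "{q \<in> U. s q \<in> W} \<inter> ?B (Suc n) = (V \<inter> {q \<in> topspace ?P. s q \<in> O'}) \<inter> ?B (Suc n)"
        using V(2) Bsub by blast
      moreover have "openin ?P (V \<inter> {q \<in> topspace ?P. s q \<in> O'})"
        using V(1) openin_continuous_map_preimage[OF contP O'(1)] by (rule openin_Int)
      ultimately show "openin (bundle_level_topology N F (Suc n)) ({q \<in> U. s q \<in> W} \<inter> ?B (Suc n))"
        unfolding bundle_level_topology_def openin_subtopology by blast
    qed
    moreover have "{q \<in> topspace (subtopology ?L U). s q \<in> W} = {q \<in> U. s q \<in> W}"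
      by (auto simp: U_def)
    ultimately show "openin (subtopology ?L U) {q \<in> topspace (subtopology ?L U). s q \<in> W}"
      using opU by (simp add: openin_open_subtopology)
  qed
  moreover have "continuous_map ?L ?L g"
    unfolding continuous_map
  proof (intro conjI allI impI)
    show "g ` topspace ?L \<subseteq> topspace ?L" using gU(1) by (auto simp: U_def)
    fix W assume W: "openin ?L W"
    show "openin ?L {q \<in> topspace ?L. g q \<in> W}"
      unfolding openin_fractafold_bundle
    proof (intro conjI allI)
      show "{q \<in> topspace ?L. g q \<in> W} \<subseteq> (\<Union>n. ?B n)" by (auto simp: topspace_fractafold_bundle)
      fix n
      obtain O' where O': "openin ?P O'" "W \<inter> ?B (Suc n) = O' \<inter> ?B (Suc n)"
        using W unfolding openin_fractafold_bundle bundle_level_topology_def openin_subtopology by blast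
      have "g q \<in> W \<longleftrightarrow> g q \<in> O'" if "q \<in> ?B n" for q
        using gB(1)[OF that] O'(2) by blast
      then have "{q \<in> topspace ?L. g q \<in> W} \<inter> ?B n = {q \<in> topspace ?P. g q \<in> O'} \<inter> ?B n"
        using Bsub BL by blast
      moreover have "openin ?P {q \<in> topspace ?P. g q \<in> O'}"
        by (rule openin_continuous_map_preimage[OF contG O'(1)])
      ultimately show "openin (bundle_level_topology N F n) ({q \<in> topspace ?L. g q \<in> W} \<inter> ?B n)"
        unfolding bundle_level_topology_def openin_subtopology by blast
    qed
  qed
  then have "continuous_map ?L (subtopology ?L U) g"
    using gU(1) by (intro continuous_map_into_subtopology) auto
  ultimately have "homeomorphic_maps (subtopology ?L U) ?L s g"
    unfolding homeomorphic_maps_def using gs gU(2) by (auto simp: U_def)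
  then have hom: "homeomorphic_map (subtopology ?L U) ?L s"
    by (rule homeomorphic_maps_imp_map)
  have topU: "topspace (subtopology ?L U) = U" by (auto simp: U_def)
  have hom\<sigma>: "homeomorphic_map (subtopology ?L U) ?L ?\<sigma>"
    by (rule homeomorphic_map_eq[OF hom]) (use \<sigma>s topU in auto)
  have "?\<sigma> ` U = topspace ?L"
    using homeomorphic_imp_surjective_map[OF hom\<sigma>] topU by simp
  moreover have "p \<in> U" using p by (simp add: U_def i_def)
  ultimately show "\<exists>U. openin ?L U \<and> p \<in> U \<and> openin ?L (?\<sigma> ` U) \<and>
      homeomorphic_map (subtopology ?L U) (subtopology ?L (?\<sigma> ` U)) ?\<sigma>"
    using opU hom\<sigma> by (intro exI[of _ U]) simp
qed


subsection \<open>Topology of the Renault--Deaconu groupoid\<close>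

lemma local_homeomorphismE:
  assumes "local_homeomorphism X Y f" "x \<in> topspace X"
  obtains U where "openin X U" "x \<in> U" "openin Y (f ` U)"
    "homeomorphic_map (subtopology X U) (subtopology Y (f ` U)) f"
  using assms unfolding local_homeomorphism_def by blast

lemma local_homeomorphism_locally:
  assumes "local_homeomorphism X Y f" "x \<in> topspace X"
  obtains U where "openin X U" "x \<in> U" "inj_on f U" "f ` U \<subseteq> topspace Y"
    "\<And>V. openin X V \<Longrightarrow> V \<subseteq> U \<Longrightarrow> openin Y (f ` V)"
    "\<And>W. openin Y W \<Longrightarrow> openin X {u \<in> U. f u \<in> W}"
proof -
  obtain U where U: "openin X U" "x \<in> U" "openin Y (f ` U)"
    and hom: "homeomorphic_map (subtopology X U) (subtopology Y (f ` U)) f"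
    using local_homeomorphismE[OF assms] by metis
  have [simp]: "topspace X \<inter> U = U" using openin_subset[OF U(1)] by blast
  have "inj_on f U"
    using homeomorphic_imp_injective_map[OF hom] by simp
  moreover have "openin Y (f ` V)" if "openin X V" "V \<subseteq> U" for V
  proof -
    have "openin (subtopology X U) V"
      using that U(1) by (simp add: openin_open_subtopology)
    then have "openin (subtopology Y (f ` U)) (f ` V)"
      using homeomorphic_imp_open_map[OF hom] by (simp add: open_map_def)
    then show ?thesis using U(3) openin_trans_full by blast
  qed
  moreover have "openin X {u \<in> U. f u \<in> W}" if "openin Y W" for W
  proof -
    have "continuous_map (subtopology X U) Y f"
      using homeomorphic_imp_continuous_map[OF hom] continuous_map_into_fulltopology by blast
    then have "openin (subtopology X U) {u \<in> topspace (subtopology X U). f u \<in> W}"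
      using that by (rule openin_continuous_map_preimage)
    then show ?thesis using U(1) openin_trans_full by fastforce
  qed
  moreover have "f ` U \<subseteq> topspace Y" using U(3) openin_subset by blast
  ultimately show ?thesis using U that by blast
qed

lemma local_homeomorphism_funpow_locally:
  assumes "local_homeomorphism Y Y \<tau>" "x \<in> topspace Y"
  shows "\<exists>U. openin Y U \<and> x \<in> U \<and> inj_on (\<tau> ^^ n) U \<and> (\<tau> ^^ n) ` U \<subseteq> topspace Y \<and>
    (\<forall>V. openin Y V \<longrightarrow> V \<subseteq> U \<longrightarrow> openin Y ((\<tau> ^^ n) ` V)) \<and>
    (\<forall>W. openin Y W \<longrightarrow> openin Y {u \<in> U. (\<tau> ^^ n) u \<in> W})"
proof (induction n)
  case 0
  have "{u \<in> topspace Y. u \<in> W} = W" if "openin Y W" for W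
    using openin_subset[OF that] by blast
  then show ?case
    using assms(2) by (intro exI[of _ "topspace Y"]) auto
next
  case (Suc n)
  obtain U where U: "openin Y U" "x \<in> U" "inj_on (\<tau> ^^ n) U" "(\<tau> ^^ n) ` U \<subseteq> topspace Y"
    and Uo: "\<And>V. openin Y V \<Longrightarrow> V \<subseteq> U \<Longrightarrow> openin Y ((\<tau> ^^ n) ` V)"
    and Uc: "\<And>W. openin Y W \<Longrightarrow> openin Y {u \<in> U. (\<tau> ^^ n) u \<in> W}"
    using Suc.IH by blast
  have x: "(\<tau> ^^ n) x \<in> topspace Y" using U(2,4) by blast
  obtain U' where U': "openin Y U'" "(\<tau> ^^ n) x \<in> U'" "inj_on \<tau> U'" "\<tau> ` U' \<subseteq> topspace Y"
    and U'o: "\<And>V. openin Y V \<Longrightarrow> V \<subseteq> U' \<Longrightarrow> openin Y (\<tau> ` V)"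
    and U'c: "\<And>W. openin Y W \<Longrightarrow> openin Y {u \<in> U'. \<tau> u \<in> W}"
    by (rule local_homeomorphism_locally[OF assms(1) x], rule that)
  define A where "A = {u \<in> U. (\<tau> ^^ n) u \<in> U'}"
  show ?case
  proof (intro exI[of _ A] conjI allI impI)
    show "openin Y A" unfolding A_def by (rule Uc[OF U'(1)])
    show "x \<in> A" using U(2) U'(2) by (simp add: A_def)
    show "inj_on (\<tau> ^^ Suc n) A"
      using U(3) U'(3) unfolding A_def inj_on_def by fastforce
    show "(\<tau> ^^ Suc n) ` A \<subseteq> topspace Y" using U'(4) by (auto simp: A_def)
  next
    fix V assume V: "openin Y V" "V \<subseteq> A"
    have "openin Y ((\<tau> ^^ n) ` V)" using V by (intro Uo) (auto simp: A_def)
    then have "openin Y (\<tau> ` (\<tau> ^^ n) ` V)" using V by (intro U'o) (auto simp: A_def)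
    then show "openin Y ((\<tau> ^^ Suc n) ` V)" by (simp add: image_comp comp_def)
  next
    fix W assume "openin Y W"
    then have "openin Y {u \<in> U. (\<tau> ^^ n) u \<in> {v \<in> U'. \<tau> v \<in> W}}" by (intro Uc U'c)
    then show "openin Y {u \<in> A. (\<tau> ^^ Suc n) u \<in> W}" by (simp add: A_def conj_assoc)
  qed
qed

lemma topspace_rd_topology:
  assumes \<tau>: "local_homeomorphism Y Y \<tau>"
  shows "topspace (rd_topology Y \<tau>) = rd_arrows Y \<tau>"
proof
  have "U \<subseteq> topspace Y" if "openin Y U" for U using that by (rule openin_subset)
  then show "topspace (rd_topology Y \<tau>) \<subseteq> rd_arrows Y \<tau>"
    unfolding rd_topology_def rd_arrows_def topology_generated_by_topspace rd_basic_def by blast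
  show "rd_arrows Y \<tau> \<subseteq> topspace (rd_topology Y \<tau>)"
  proof
    fix g assume "g \<in> rd_arrows Y \<tau>"
    then obtain x m n y where g: "g = (x, int m - int n, y)" "x \<in> topspace Y" "y \<in> topspace Y"
      and eq: "(\<tau> ^^ m) x = (\<tau> ^^ n) y"
      unfolding rd_arrows_def by blast
    obtain U where U: "openin Y U" "x \<in> U" "inj_on (\<tau> ^^ m) U"
      and Uo: "\<And>V. openin Y V \<Longrightarrow> V \<subseteq> U \<Longrightarrow> openin Y ((\<tau> ^^ m) ` V)"
      and Uc: "\<And>W. openin Y W \<Longrightarrow> openin Y {u \<in> U. (\<tau> ^^ m) u \<in> W}"
      using local_homeomorphism_funpow_locally[OF \<tau> g(2), of m] by blast
    obtain V where V: "openin Y V" "y \<in> V" "inj_on (\<tau> ^^ n) V"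
      and Vo: "\<And>W. openin Y W \<Longrightarrow> W \<subseteq> V \<Longrightarrow> openin Y ((\<tau> ^^ n) ` W)"
      and Vc: "\<And>W. openin Y W \<Longrightarrow> openin Y {u \<in> V. (\<tau> ^^ n) u \<in> W}"
      using local_homeomorphism_funpow_locally[OF \<tau> g(3), of n] by blast
    define W where "W = (\<tau> ^^ m) ` U \<inter> (\<tau> ^^ n) ` V"
    have W: "openin Y W" unfolding W_def using Uo[OF U(1)] Vo[OF V(1)] by auto
    have W1: "W \<subseteq> (\<tau> ^^ m) ` U" and W2: "W \<subseteq> (\<tau> ^^ n) ` V" unfolding W_def by auto
    define U' where "U' = {u \<in> U. (\<tau> ^^ m) u \<in> W}"
    define V' where "V' = {u \<in> V. (\<tau> ^^ n) u \<in> W}"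
    have "openin Y U'" "openin Y V'" unfolding U'_def V'_def by (rule Uc[OF W], rule Vc[OF W])
    moreover have "inj_on (\<tau> ^^ m) U'" "inj_on (\<tau> ^^ n) V'"
      using U(3) V(3) by (auto simp: U'_def V'_def inj_on_def)
    moreover have "(\<tau> ^^ m) ` U' = W" "(\<tau> ^^ n) ` V' = W"
      using W1 W2 by (auto simp: U'_def V'_def)
    moreover have "x \<in> U'" "y \<in> V'"
      using U(2) V(2) eq imageI[OF U(2), of "\<tau> ^^ m"] imageI[OF V(2), of "\<tau> ^^ n"]
      by (auto simp: U'_def V'_def W_def)
    then have "g \<in> rd_basic \<tau> m n U' V'" unfolding rd_basic_def using g(1) eq by blast
    ultimately show "g \<in> topspace (rd_topology Y \<tau>)"
      unfolding rd_topology_def topology_generated_by_topspace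
      by (intro UnionI[of "rd_basic \<tau> m n U' V'"] CollectI exI[of _ m] exI[of _ n] exI[of _ U'] exI[of _ V'])
        simp_all
  qed
qed

end

theory Submission
  imports Defs
begin

text \<open>The anchor \<open>p\<close> from the bundle to the sequence space intertwines \<open>lifted_shift F\<close> with the
  shift, and the lifted shift is bijective between fibres of \<open>p\<close>. Hence \<open>\<gamma> \<cdot> z\<close>, for
  \<open>\<gamma> = (x, m - n, p z)\<close>, is the only point \<open>w\<close> over \<open>x\<close> whose \<open>m\<close>-th iterate is the \<open>n\<close>-th iterate
  of \<open>z\<close>, so that \<open>(\<gamma>, z) \<mapsto> (\<gamma> \<cdot> z, m - n, z)\<close> is a bijection of groupoids with inverse
  \<open>(w, k, z) \<mapsto> ((p w, k, p z), z)\<close>. Both maps are continuous because a basic open set is determined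
  by a pair of open sets on which the iterates are injective, and \<open>p\<close> pulls such pairs back after
  shrinking.\<close>

section \<open>Neighbourhoods and continuity in Renault--Deaconu groupoids\<close>

lemma local_homeomorphism_funpow_in_topspace:
  assumes "local_homeomorphism Y Y \<tau>" "x \<in> topspace Y"
  shows "(\<tau> ^^ n) x \<in> topspace Y"
  using local_homeomorphism_funpow_locally[OF assms, of n] by blast

lemma openin_rd_basic:
  assumes "openin Y U" "openin Y V" "inj_on (\<tau> ^^ m) U" "inj_on (\<tau> ^^ n) V"
    and "(\<tau> ^^ m) ` U = (\<tau> ^^ n) ` V"
  shows "openin (rd_topology Y \<tau>) (rd_basic \<tau> m n U V)"
  unfolding rd_topology_def using assms by (intro topology_generated_by_Basis) blast

text \<open>Generators come from pairs of sets with the same image, so the two sides have to be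
  shrunk together. Both are cut down to the preimages of one open set \<open>W\<close>, the
  intersection of the images of small neighbourhoods of \<open>x\<close> and \<open>y\<close>; it
  contains the common value of the two iterates. The exponents \<open>m\<close> and \<open>n\<close>
  stay fixed.\<close>

lemma rd_basic_neighbourhood:
  assumes \<tau>: "local_homeomorphism Y Y \<tau>"
    and x: "openin Y A" "x \<in> A" and y: "openin Y B" "y \<in> B" and eq: "(\<tau> ^^ m) x = (\<tau> ^^ n) y"
  obtains U V where "openin Y U" "openin Y V" "inj_on (\<tau> ^^ m) U" "inj_on (\<tau> ^^ n) V"
    "(\<tau> ^^ m) ` U = (\<tau> ^^ n) ` V" "x \<in> U" "U \<subseteq> A" "y \<in> V" "V \<subseteq> B"
proof -
  have xY: "x \<in> topspace Y" and yY: "y \<in> topspace Y"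
    using x y openin_subset by blast+
  obtain U where U: "openin Y U" "x \<in> U" "inj_on (\<tau> ^^ m) U"
    and Uo: "\<And>V. openin Y V \<Longrightarrow> V \<subseteq> U \<Longrightarrow> openin Y ((\<tau> ^^ m) ` V)"
    and Uc: "\<And>W. openin Y W \<Longrightarrow> openin Y {u \<in> U. (\<tau> ^^ m) u \<in> W}"
    using local_homeomorphism_funpow_locally[OF \<tau> xY, of m] by blast
  obtain V where V: "openin Y V" "y \<in> V" "inj_on (\<tau> ^^ n) V"
    and Vo: "\<And>W. openin Y W \<Longrightarrow> W \<subseteq> V \<Longrightarrow> openin Y ((\<tau> ^^ n) ` W)"
    and Vc: "\<And>W. openin Y W \<Longrightarrow> openin Y {u \<in> V. (\<tau> ^^ n) u \<in> W}"
    using local_homeomorphism_funpow_locally[OF \<tau> yY, of n] by blast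
  define W where "W = (\<tau> ^^ m) ` (U \<inter> A) \<inter> (\<tau> ^^ n) ` (V \<inter> B)"
  have W: "openin Y W"
    unfolding W_def using Uo[of "U \<inter> A"] Vo[of "V \<inter> B"] U(1) V(1) x(1) y(1) by auto
  have W1: "W \<subseteq> (\<tau> ^^ m) ` (U \<inter> A)" and W2: "W \<subseteq> (\<tau> ^^ n) ` (V \<inter> B)"
    unfolding W_def by auto
  define U' where "U' = {u \<in> U. (\<tau> ^^ m) u \<in> W} \<inter> A"
  define V' where "V' = {u \<in> V. (\<tau> ^^ n) u \<in> W} \<inter> B"
  have "openin Y U'" "openin Y V'"
    unfolding U'_def V'_def using Uc[OF W] Vc[OF W] x(1) y(1) by (auto intro: openin_Int)
  moreover have "inj_on (\<tau> ^^ m) U'" "inj_on (\<tau> ^^ n) V'"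
    using U(3) V(3) by (auto simp: U'_def V'_def inj_on_def)
  moreover have "(\<tau> ^^ m) ` U' = W" "(\<tau> ^^ n) ` V' = W"
    using W1 W2 unfolding U'_def V'_def by blast+
  moreover have "(\<tau> ^^ m) x \<in> W"
    unfolding W_def using U(2) V(2) x(2) y(2) eq by (metis IntI imageI)
  then have "x \<in> U'" "y \<in> V'"
    using U(2) V(2) x(2) y(2) eq by (auto simp: U'_def V'_def)
  ultimately show ?thesis
    using that[of U' V'] by (simp add: U'_def V'_def)
qed

lemma rd_basic_iff:
  "(x, k, y) \<in> rd_basic \<tau> m n U V \<longleftrightarrow>
     k = int m - int n \<and> (\<tau> ^^ m) x = (\<tau> ^^ n) y \<and> x \<in> U \<and> y \<in> V"
  unfolding rd_basic_def by blast

lemma rd_arrows_iff: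
  "(x, k, y) \<in> rd_arrows Y \<tau> \<longleftrightarrow> x \<in> topspace Y \<and> y \<in> topspace Y \<and>
     (\<exists>m n. k = int m - int n \<and> (\<tau> ^^ m) x = (\<tau> ^^ n) y)"
  unfolding rd_arrows_def by blast

text \<open>The topology is given by generators, so it suffices to look at preimages of generators,
  and their openness may be checked point by point.\<close>

lemma continuous_map_into_rd_topology:
  assumes Y: "local_homeomorphism Y Y \<tau>"
    and into: "\<And>q. q \<in> topspace Z \<Longrightarrow> f q \<in> rd_arrows Y \<tau>"
    and nbhd: "\<And>q m n U V. q \<in> topspace Z \<Longrightarrow> openin Y U \<Longrightarrow> openin Y V \<Longrightarrow>
      inj_on (\<tau> ^^ m) U \<Longrightarrow> inj_on (\<tau> ^^ n) V \<Longrightarrow> f q \<in> rd_basic \<tau> m n U V \<Longrightarrow>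
      \<exists>W. openin Z W \<and> q \<in> W \<and> f ` W \<subseteq> rd_basic \<tau> m n U V"
  shows "continuous_map Z (rd_topology Y \<tau>) f"
  unfolding rd_topology_def continuous_on_generated_topo_iff
proof (intro conjI allI impI)
  let ?S = "{rd_basic \<tau> m n U V | m n U V. openin Y U \<and> openin Y V \<and> inj_on (\<tau> ^^ m) U \<and>
      inj_on (\<tau> ^^ n) V \<and> (\<tau> ^^ m) ` U = (\<tau> ^^ n) ` V}"
  show "f ` topspace Z \<subseteq> \<Union> ?S"
    using into unfolding topspace_rd_topology[OF Y, unfolded rd_topology_def
        topology_generated_by_topspace] by blast
  fix B assume "B \<in> ?S"
  then obtain m n U V where B: "B = rd_basic \<tau> m n U V" "openin Y U" "openin Y V"
    "inj_on (\<tau> ^^ m) U" "inj_on (\<tau> ^^ n) V"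
    by blast
  show "openin Z (f -` B \<inter> topspace Z)"
  proof (subst openin_subopen, intro ballI)
    fix q assume q: "q \<in> f -` B \<inter> topspace Z"
    then obtain W where W: "openin Z W" "q \<in> W" "f ` W \<subseteq> B"
      using nbhd[of q U V m n] B by blast
    then show "\<exists>W. openin Z W \<and> q \<in> W \<and> W \<subseteq> f -` B \<inter> topspace Z"
      using openin_subset[OF W(1)] by (intro exI[of _ W]) blast
  qed
qed

section \<open>Lifts of a local homeomorphism along an anchor map\<close>

text \<open>Isolates what the argument uses of the bundle. The assumption \<open>act\<close>
  provides a point over \<open>x\<close> that is tied to \<open>z\<close> by the same exponents as
  \<open>x\<close> is to \<open>p z\<close>, and \<open>fibre_inj\<close> makes it the only such
  point; no formula for the action enters.\<close>

locale lifted_dynamics =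
  fixes X :: "'x topology" and \<sigma> :: "'x \<Rightarrow> 'x" and L :: "'z topology" and \<tau> :: "'z \<Rightarrow> 'z"
    and p :: "'z \<Rightarrow> 'x" and act :: "'x \<times> int \<times> 'x \<Rightarrow> 'z \<Rightarrow> 'z"
  assumes \<sigma>: "local_homeomorphism X X \<sigma>" and \<tau>: "local_homeomorphism L L \<tau>"
    and p: "continuous_map L X p"
    and p_\<tau>: "z \<in> topspace L \<Longrightarrow> p (\<tau> z) = \<sigma> (p z)"
    and fibre_inj: "inj_on \<tau> {z \<in> topspace L. p z = x}"
    and act: "x \<in> topspace X \<Longrightarrow> z \<in> topspace L \<Longrightarrow> (\<sigma> ^^ m) x = (\<sigma> ^^ n) (p z) \<Longrightarrow>
      act (x, int m - int n, p z) z \<in> topspace L \<and> p (act (x, int m - int n, p z) z) = x \<and>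
      (\<tau> ^^ m) (act (x, int m - int n, p z) z) = (\<tau> ^^ n) z"
begin

lemmas \<tau>_in = local_homeomorphism_funpow_in_topspace[OF \<tau>]

lemma p_in: "z \<in> topspace L \<Longrightarrow> p z \<in> topspace X"
  using p by (auto simp: continuous_map_def)

lemma p_funpow: "z \<in> topspace L \<Longrightarrow> p ((\<tau> ^^ n) z) = (\<sigma> ^^ n) (p z)"
  by (induction n) (auto simp: p_\<tau> \<tau>_in)

text \<open>The \<open>n\<close>-th iterates of \<open>w\<close> and \<open>z\<close> lie in one
  fibre, over \<open>(\<sigma> ^^ n) (p z)\<close>, so the outermost \<tau> can be cancelled there;
  induction removes the rest.\<close>

lemma fibre_inj_funpow:
  assumes "w \<in> topspace L" "z \<in> topspace L" "p w = p z" "(\<tau> ^^ n) w = (\<tau> ^^ n) z"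
  shows "w = z"
  using assms(4)
proof (induction n)
  case (Suc n)
  have "(\<tau> ^^ n) w = (\<tau> ^^ n) z"
    by (rule inj_onD[OF fibre_inj[of "(\<sigma> ^^ n) (p z)"]])
      (use Suc.prems assms in \<open>auto simp: \<tau>_in p_funpow\<close>)
  then show ?case by (rule Suc.IH)
qed simp

text \<open>The action value and \<open>w\<close> lie over the same point and have the same
  \<open>m\<close>-th iterate, hence they coincide.\<close>

lemma act_eq:
  assumes "w \<in> topspace L" "z \<in> topspace L" "(\<tau> ^^ m) w = (\<tau> ^^ n) z"
  shows "act (p w, int m - int n, p z) z = w"
proof -
  have "(\<sigma> ^^ m) (p w) = (\<sigma> ^^ n) (p z)"
    using p_funpow[OF assms(1), of m] p_funpow[OF assms(2), of n] assms(3) by simp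
  note a = act[OF p_in[OF assms(1)] assms(2) this]
  show ?thesis
    by (rule fibre_inj_funpow[where n = m]) (use a assms in simp_all)
qed

text \<open>The action sees only the difference of the exponents. By \<open>act_eq\<close> for
  \<open>m'\<close> and \<open>n'\<close> its value is \<open>w\<close>, while \<open>act\<close>
  for \<open>m\<close> and \<open>n\<close> states the wanted equation for this value. Thus a
  relation in the base can be lifted with its own exponents.\<close>

lemma funpow_eq_descend:
  assumes "w \<in> topspace L" "z \<in> topspace L" "(\<tau> ^^ m') w = (\<tau> ^^ n') z"
    and "int m - int n = int m' - int n'" "(\<sigma> ^^ m) (p w) = (\<sigma> ^^ n) (p z)"
  shows "(\<tau> ^^ m) w = (\<tau> ^^ n) z"
  using act[OF p_in[OF assms(1)] assms(2,5)] act_eq[OF assms(1-3)] unfolding assms(4) by simp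

section \<open>The two groupoids and the mutually inverse bijections\<close>

abbreviation "\<G> \<equiv> action_groupoid (renault_deaconu X \<sigma>) L p act"

abbreviation "\<H> \<equiv> renault_deaconu L \<tau>"

definition \<phi> :: "('x \<times> int \<times> 'x) \<times> 'z \<Rightarrow> 'z \<times> int \<times> 'z" where
  "\<phi> = (\<lambda>((x, k, y), z). (act (x, k, y) z, k, z))"

definition \<psi> :: "'z \<times> int \<times> 'z \<Rightarrow> ('x \<times> int \<times> 'x) \<times> 'z" where
  "\<psi> = (\<lambda>(w, k, z). ((p w, k, p z), z))"

lemma arrow_space_\<H>: "arrow_space \<H> = rd_topology L \<tau>"
  by (simp add: renault_deaconu_def)

lemma arrows_\<H>: "arrows \<H> = rd_arrows L \<tau>"
  by (simp add: arrow_space_\<H> topspace_rd_topology[OF \<tau>])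

lemma arrow_space_\<G>: "arrow_space \<G> =
  subtopology (prod_topology (rd_topology X \<sigma>) L)
    {((x, k, y), z). (x, k, y) \<in> rd_arrows X \<sigma> \<and> z \<in> topspace L \<and> y = p z}"
  unfolding action_groupoid_def renault_deaconu_def
  by (simp add: topspace_rd_topology[OF \<sigma>] case_prod_unfold)

lemma arrows_\<G>: "arrows \<G> =
    {((x, k, y), z). (x, k, y) \<in> rd_arrows X \<sigma> \<and> z \<in> topspace L \<and> y = p z}"
  unfolding arrow_space_\<G> by (auto simp: topspace_rd_topology[OF \<sigma>])

text \<open>Taking the action value for \<open>w\<close> parametrises the arrows of \<G> by related
  pairs in \<open>L\<close>; in these coordinates \<phi> and \<psi> only rearrange \<open>w\<close>
  and \<open>z\<close>.\<close>

lemma arrows_\<G>_cases: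
  assumes "q \<in> arrows \<G>"
  obtains w m n z where "w \<in> topspace L" "z \<in> topspace L" "(\<tau> ^^ m) w = (\<tau> ^^ n) z"
    "q = ((p w, int m - int n, p z), z)"
proof -
  from assms obtain x m n z where q: "q = ((x, int m - int n, p z), z)" "x \<in> topspace X"
    "z \<in> topspace L" "(\<sigma> ^^ m) x = (\<sigma> ^^ n) (p z)"
    unfolding arrows_\<G> rd_arrows_def by blast
  show ?thesis
    using act[OF q(2-4)] q that[of "act (x, int m - int n, p z) z" z m n] by auto
qed

lemma \<phi>_eq:
  assumes "w \<in> topspace L" "z \<in> topspace L" "(\<tau> ^^ m) w = (\<tau> ^^ n) z"
  shows "\<phi> ((p w, int m - int n, p z), z) = (w, int m - int n, z)"
  by (simp add: \<phi>_def act_eq[OF assms])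

lemma \<psi>_in: "q \<in> arrows \<H> \<Longrightarrow> \<psi> q \<in> arrows \<G>"
proof -
  assume "q \<in> arrows \<H>"
  then obtain w m n z where q: "q = (w, int m - int n, z)" "w \<in> topspace L" "z \<in> topspace L"
    "(\<tau> ^^ m) w = (\<tau> ^^ n) z"
    unfolding arrows_\<H> rd_arrows_def by blast
  then have "(\<sigma> ^^ m) (p w) = (\<sigma> ^^ n) (p z)"
    using p_funpow[of w m] p_funpow[of z n] by simp
  then show ?thesis
    using q p_in unfolding arrows_\<G> \<psi>_def by (auto simp: rd_arrows_iff)
qed

lemma \<phi>_in: "q \<in> arrows \<G> \<Longrightarrow> \<phi> q \<in> arrows \<H>"
  by (erule arrows_\<G>_cases) (auto simp: \<phi>_eq arrows_\<H> rd_arrows_iff)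

lemma \<psi>_\<phi>: "q \<in> arrows \<G> \<Longrightarrow> \<psi> (\<phi> q) = q"
  by (erule arrows_\<G>_cases) (simp add: \<phi>_eq \<psi>_def)

lemma \<phi>_\<psi>: "q \<in> arrows \<H> \<Longrightarrow> \<phi> (\<psi> q) = q"
  by (auto simp: \<phi>_eq arrows_\<H> rd_arrows_def \<psi>_def)

section \<open>Continuity in both directions\<close>

lemma continuous_\<phi>: "continuous_map (arrow_space \<G>) (arrow_space \<H>) \<phi>"
  unfolding arrow_space_\<H>
proof (rule continuous_map_into_rd_topology[OF \<tau>])
  show "\<phi> q \<in> rd_arrows L \<tau>" if "q \<in> arrows \<G>" for q
    using \<phi>_in[OF that] by (simp add: arrows_\<H>)
  fix q m n U V
  assume q: "q \<in> arrows \<G>" and U: "openin L U" and V: "openin L V"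
    and "\<phi> q \<in> rd_basic \<tau> m n U V"
  then obtain w z where \<phi>q: "\<phi> q = (w, int m - int n, z)" and eq: "(\<tau> ^^ m) w = (\<tau> ^^ n) z"
    and w: "w \<in> U" and z: "z \<in> V"
    unfolding rd_basic_def by blast
  have wL: "w \<in> topspace L" and zL: "z \<in> topspace L"
    using U V w z openin_subset by blast+
  have qe: "q = ((p w, int m - int n, p z), z)"
    using \<psi>_\<phi>[OF q] by (simp add: \<phi>q \<psi>_def)
  have peq: "(\<sigma> ^^ m) (p w) = (\<sigma> ^^ n) (p z)"
    using p_funpow[OF wL, of m] p_funpow[OF zL, of n] eq by simp
  \<comment> \<open>Injectivity of \<open>\<sigma> ^^ m\<close> on \<open>A\<close> will later
    identify a base point from its \<open>m\<close>-th iterate.\<close>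
  obtain A B where A: "openin X A" "inj_on (\<sigma> ^^ m) A" "p w \<in> A"
    and B: "openin X B" "inj_on (\<sigma> ^^ n) B" "p z \<in> B"
    and AB: "(\<sigma> ^^ m) ` A = (\<sigma> ^^ n) ` B"
    by (rule rd_basic_neighbourhood[OF \<sigma> openin_topspace p_in[OF wL] openin_topspace p_in[OF zL] peq])
  \<comment> \<open>Points of \<open>U'\<close> have to project into \<open>A\<close>, so the lift
    is shrunk inside the preimage of \<open>A\<close>. The equality of images gives every point of
    \<open>V'\<close> a partner in \<open>U'\<close>.\<close>
  obtain U' V' where U': "w \<in> U'" "U' \<subseteq> U \<inter> {u \<in> topspace L. p u \<in> A}"
    and V': "openin L V'" "z \<in> V'" "V' \<subseteq> V"
    and UV': "(\<tau> ^^ m) ` U' = (\<tau> ^^ n) ` V'"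
  proof (rule rd_basic_neighbourhood[OF \<tau> _ _ V z eq])
    show "openin L (U \<inter> {u \<in> topspace L. p u \<in> A})"
      using U openin_continuous_map_preimage[OF p A(1)] by (rule openin_Int)
    show "w \<in> U \<inter> {u \<in> topspace L. p u \<in> A}" using w wL A(3) by simp
  qed
  define W where "W = (rd_basic \<sigma> m n A B \<times> V') \<inter> arrows \<G>"
  have "openin (prod_topology (rd_topology X \<sigma>) L) (rd_basic \<sigma> m n A B \<times> V')"
    using openin_rd_basic[OF A(1) B(1) A(2) B(2) AB] V'(1) by (simp add: openin_prod_Times_iff)
  then have "openin (arrow_space \<G>) W"
    unfolding W_def arrows_\<G> unfolding arrow_space_\<G> openin_subtopology by blast
  moreover have "q \<in> W"
    using q A(3) B(3) V'(2) peq by (simp add: W_def qe rd_basic_iff)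
  moreover have "\<phi> g \<in> rd_basic \<tau> m n U V" if g: "g \<in> W" for g
  proof -
    obtain x z' where g': "g = ((x, int m - int n, p z'), z')" "(\<sigma> ^^ m) x = (\<sigma> ^^ n) (p z')"
      "x \<in> A" "z' \<in> V'" "z' \<in> topspace L"
      using g unfolding W_def arrows_\<G> rd_basic_def by blast
    \<comment> \<open>The partner \<open>w'\<close> of \<open>z'\<close> is the candidate for the
      action value. Both \<open>p w'\<close> and \<open>x\<close> lie in \<open>A\<close> and have
      the same \<open>m\<close>-th iterate, so \<open>w'\<close> lies over \<open>x\<close>, and
      \<open>\<phi>_eq\<close> applies.\<close>
    obtain w' where w': "w' \<in> U'" "(\<tau> ^^ m) w' = (\<tau> ^^ n) z'"
      using UV' g'(4) by (metis image_iff)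
    have w'L: "w' \<in> topspace L" and w'U: "w' \<in> U" and w'A: "p w' \<in> A" using w'(1) U'(2) by blast+
    have "(\<sigma> ^^ m) (p w') = (\<sigma> ^^ m) x"
      using p_funpow[OF w'L, of m] p_funpow[OF g'(5), of n] w'(2) g'(2) by simp
    then have "p w' = x" using A(2) w'A g'(3) by (simp add: inj_on_def)
    then show ?thesis
      using \<phi>_eq[OF w'L g'(5) w'(2)] g'(1,4) w'(2) w'U V'(3) by (auto simp: rd_basic_iff)
  qed
  ultimately show "\<exists>W. openin (arrow_space \<G>) W \<and> q \<in> W \<and> \<phi> ` W \<subseteq> rd_basic \<tau> m n U V"
    by blast
qed

text \<open>Makes \<open>rd_basic\<close> usable for arbitrary open \<open>A\<close> and
  \<open>B\<close>, although only pairs with the injectivity and image conditions occur among the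
  generators.\<close>

lemma rd_neighbourhood:
  assumes "openin L A" "w \<in> A" "openin L B" "z \<in> B" "(\<tau> ^^ m) w = (\<tau> ^^ n) z"
  shows "\<exists>W. openin (rd_topology L \<tau>) W \<and> (w, int m - int n, z) \<in> W \<and> W \<subseteq> rd_basic \<tau> m n A B"
proof -
  obtain U V where UV: "openin L U" "openin L V" "inj_on (\<tau> ^^ m) U" "inj_on (\<tau> ^^ n) V"
    "(\<tau> ^^ m) ` U = (\<tau> ^^ n) ` V" and "w \<in> U" "U \<subseteq> A" "z \<in> V" "V \<subseteq> B"
    by (rule rd_basic_neighbourhood[OF \<tau> assms])
  then show ?thesis
    using openin_rd_basic[OF UV] assms(5)
    by (intro exI[of _ "rd_basic \<tau> m n U V"]) (auto simp: rd_basic_def)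
qed

lemma continuous_source: "continuous_map (rd_topology L \<tau>) L (\<lambda>(w, k, z). z)"
  unfolding continuous_map
proof (intro conjI allI impI)
  show "(\<lambda>(w, k, z). z) ` topspace (rd_topology L \<tau>) \<subseteq> topspace L"
    by (auto simp: topspace_rd_topology[OF \<tau>] rd_arrows_def)
  fix V assume V: "openin L V"
  show "openin (rd_topology L \<tau>) {q \<in> topspace (rd_topology L \<tau>). (case q of (w, k, z) \<Rightarrow> z) \<in> V}"
    (is "openin _ ?P")
  proof (subst openin_subopen, intro ballI)
    fix q assume "q \<in> ?P"
    then obtain w m n z where q: "q = (w, int m - int n, z)" "w \<in> topspace L" "z \<in> V"
      "(\<tau> ^^ m) w = (\<tau> ^^ n) z"
      unfolding topspace_rd_topology[OF \<tau>] rd_arrows_def by auto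
    obtain W where W: "openin (rd_topology L \<tau>) W" "q \<in> W" "W \<subseteq> rd_basic \<tau> m n (topspace L) V"
      using rd_neighbourhood[OF openin_topspace q(2) V q(3,4)] q(1) by blast
    have "W \<subseteq> ?P"
      using W(3) openin_subset[OF W(1)] by (fastforce simp: rd_basic_def)
    then show "\<exists>W. openin (rd_topology L \<tau>) W \<and> q \<in> W \<and> W \<subseteq> ?P"
      using W by blast
  qed
qed

lemma continuous_base: "continuous_map (rd_topology L \<tau>) (rd_topology X \<sigma>) (\<lambda>(w, k, z). (p w, k, p z))"
  (is "continuous_map _ _ ?f")
proof (rule continuous_map_into_rd_topology[OF \<sigma>])
  show "?f q \<in> rd_arrows X \<sigma>" if "q \<in> topspace (rd_topology L \<tau>)" for q
    using \<psi>_in[of q] that unfolding arrow_space_\<H>[symmetric] arrows_\<G> \<psi>_def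
    by (cases q) auto
  fix q m n A B
  assume q: "q \<in> topspace (rd_topology L \<tau>)" and A: "openin X A" and B: "openin X B"
    and fq: "?f q \<in> rd_basic \<sigma> m n A B"
  obtain w m' n' z where qe: "q = (w, int m' - int n', z)" "w \<in> topspace L" "z \<in> topspace L"
    "(\<tau> ^^ m') w = (\<tau> ^^ n') z"
    using q unfolding topspace_rd_topology[OF \<tau>] rd_arrows_def by blast
  have k: "int m - int n = int m' - int n'" and peq: "(\<sigma> ^^ m) (p w) = (\<sigma> ^^ n) (p z)"
    and wA: "p w \<in> A" and zB: "p z \<in> B"
    using fq by (auto simp: qe(1) rd_basic_iff)
  define A' where "A' = {u \<in> topspace L. p u \<in> A}"
  define B' where "B' = {u \<in> topspace L. p u \<in> B}"
  have "openin L A'" "w \<in> A'" "openin L B'" "z \<in> B'"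
    unfolding A'_def B'_def using openin_continuous_map_preimage[OF p] A B qe(2,3) wA zB by auto
  \<comment> \<open>The exponents \<open>m'\<close> and \<open>n'\<close> witnessing the arrow
    \<open>q\<close> may differ from the exponents \<open>m\<close> and \<open>n\<close> of the
    given basic set in the base; \<open>funpow_eq_descend\<close> passes to the latter.\<close>
  from rd_neighbourhood[OF this funpow_eq_descend[OF qe(2-4) k peq]]
  obtain W where W: "openin (rd_topology L \<tau>) W" "q \<in> W" "W \<subseteq> rd_basic \<tau> m n A' B'"
    unfolding qe(1) k by blast
  have "?f g \<in> rd_basic \<sigma> m n A B" if gW: "g \<in> W" for g
  proof -
    obtain w z where g: "g = (w, int m - int n, z)" "w \<in> A'" "z \<in> B'" "(\<tau> ^^ m) w = (\<tau> ^^ n) z"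
      using W(3) gW unfolding rd_basic_def by blast
    then have "(\<sigma> ^^ m) (p w) = (\<sigma> ^^ n) (p z)"
      using p_funpow[of w m] p_funpow[of z n] by (simp add: A'_def B'_def)
    then show ?thesis using g by (simp add: rd_basic_iff A'_def B'_def)
  qed
  then show "\<exists>W. openin (rd_topology L \<tau>) W \<and> q \<in> W \<and> ?f ` W \<subseteq> rd_basic \<sigma> m n A B"
    using W(1,2) by blast
qed

lemma continuous_\<psi>: "continuous_map (arrow_space \<H>) (arrow_space \<G>) \<psi>"
  unfolding arrow_space_\<G>
proof (rule continuous_map_into_subtopology)
  show "continuous_map (arrow_space \<H>) (prod_topology (rd_topology X \<sigma>) L) \<psi>"
  proof -
    have "fst \<circ> \<psi> = (\<lambda>(w, k, z). (p w, k, p z))" "snd \<circ> \<psi> = (\<lambda>(w, k, z). z)"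
      by (auto simp: \<psi>_def fun_eq_iff)
    then show ?thesis
      unfolding continuous_map_pairwise arrow_space_\<H> using continuous_base continuous_source by metis
  qed
  show "\<psi> \<in> arrows \<H> \<rightarrow>
      {((x, k, y), z). (x, k, y) \<in> rd_arrows X \<sigma> \<and> z \<in> topspace L \<and> y = p z}"
    unfolding arrows_\<G>[symmetric] by (rule Pi_I) (rule \<psi>_in)
qed

lemma homeomorphic_\<phi>: "homeomorphic_map (arrow_space \<G>) (arrow_space \<H>) \<phi>"
  by (rule homeomorphic_maps_imp_map[where g = \<psi>])
    (simp add: homeomorphic_maps_def continuous_\<phi> continuous_\<psi> \<psi>_\<phi> \<phi>_\<psi>)

section \<open>Compatibility with the groupoid structure\<close>

text \<open>Units of both groupoids are points of \<open>L\<close>, and the outer entries of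
  \<open>\<phi> (\<gamma>, z)\<close> are literally the range and the source of
  \<open>(\<gamma>, z)\<close>.\<close>

lemma composable_\<phi>:
  assumes "g \<in> arrows \<G>" "h \<in> arrows \<G>"
  shows "composable \<G> g h \<longleftrightarrow> composable \<H> (\<phi> g) (\<phi> h)"
proof -
  have "source_map \<G> g = range_map \<G> h \<longleftrightarrow> source_map \<H> (\<phi> g) = range_map \<H> (\<phi> h)"
    by (cases g; cases h) (auto simp: action_groupoid_def renault_deaconu_def \<phi>_def)
  then show ?thesis
    using assms \<phi>_in[OF assms(1)] \<phi>_in[OF assms(2)] unfolding composable_def by blast
qed

lemma \<phi>_mult:
  assumes "composable \<G> g h"
  shows "\<phi> (mult \<G> g h) = mult \<H> (\<phi> g) (\<phi> h)"
proof -
  have gh: "g \<in> arrows \<G>" "h \<in> arrows \<G>" using assms by (auto simp: composable_def)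
  obtain w m n z where w: "w \<in> topspace L" "z \<in> topspace L" "(\<tau> ^^ m) w = (\<tau> ^^ n) z"
    and g: "g = ((p w, int m - int n, p z), z)"
    by (rule arrows_\<G>_cases[OF gh(1)])
  obtain w' m' n' z' where
    w': "w' \<in> topspace L" "z' \<in> topspace L" "(\<tau> ^^ m') w' = (\<tau> ^^ n') z'"
    and h: "h = ((p w', int m' - int n', p z'), z')"
    by (rule arrows_\<G>_cases[OF gh(2)])
  \<comment> \<open>Composability says that \<open>z\<close> is the action value of
    \<open>h\<close>, which is \<open>w'\<close> by \<open>act_eq\<close>.\<close>
  have "z = w'"
    using assms by (simp add: composable_def action_groupoid_def g h act_eq[OF w'])
  \<comment> \<open>Applying \<open>\<tau> ^^ m'\<close> to the relation for \<open>g\<close> and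
    \<open>\<tau> ^^ n\<close> to the one for \<open>h\<close> makes them meet at
    \<open>z = w'\<close>. The exponents of the resulting relation differ by the sum of the two
    degrees.\<close>
  have "(\<tau> ^^ (m' + m)) w = (\<tau> ^^ (m' + n)) z"
    by (simp add: funpow_add w(3))
  also have "\<dots> = (\<tau> ^^ (n + n')) z'"
    unfolding add.commute[of m' n] by (simp add: funpow_add \<open>z = w'\<close> w'(3))
  finally have "(\<tau> ^^ (m' + m)) w = (\<tau> ^^ (n + n')) z'" .
  from \<phi>_eq[OF w(1) w'(2) this]
  show ?thesis
    unfolding action_groupoid_def renault_deaconu_def
    by (simp add: g h \<phi>_eq[OF w] \<phi>_eq[OF w'] algebra_simps)
qed

text \<open>The inverse in \<G> carries the action value \<open>w\<close> as its second component,
  so it is the arrow of the reversed relation and \<open>\<phi>_eq\<close> applies with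
  \<open>w\<close> and \<open>z\<close> exchanged.\<close>

lemma \<phi>_inverse:
  assumes "g \<in> arrows \<G>"
  shows "\<phi> (inverse_map \<G> g) = inverse_map \<H> (\<phi> g)"
proof -
  from assms obtain w m n z where w: "w \<in> topspace L" "z \<in> topspace L" "(\<tau> ^^ m) w = (\<tau> ^^ n) z"
    and g: "g = ((p w, int m - int n, p z), z)"
    by (rule arrows_\<G>_cases)
  from \<phi>_eq[OF w(2,1) w(3)[symmetric]] show ?thesis
    unfolding action_groupoid_def renault_deaconu_def
    by (simp add: g \<phi>_eq[OF w] act_eq[OF w])
qed

theorem action_groupoid_isomorphic: "topological_groupoid_isomorphic \<G> \<H>"
  unfolding topological_groupoid_isomorphic_def topological_groupoid_iso_def
  using homeomorphic_\<phi> composable_\<phi> \<phi>_mult \<phi>_inverse by blast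

end

section \<open>The fractafold bundle as an instance\<close>

lemma funpow_lifted_shift:
  "(lifted_shift F ^^ n) (x, t) = ((stl ^^ n) x, word_map F (stake n x) t)"
  by (induction n arbitrary: x t) (simp_all add: lifted_shift_def funpow_Suc_right del: funpow.simps(2))

lemma in_fractafold_bundle_iff:
  "(x, t) \<in> topspace (fractafold_bundle N F) \<longleftrightarrow>
     x \<in> streams {1..N} \<and> (\<exists>n. word_map F (stake n x) t \<in> attractor N F)"
  by (simp add: topspace_fractafold_bundle bundle_level_iff)

text \<open>Membership asks for some prefix whose word map brings \<open>t\<close> into the
  attractor. A prefix that works after \<open>m\<close> steps, preceded by the first
  \<open>m\<close> letters of \<open>x\<close>, works at the start.\<close>

lemma in_fractafold_bundle_if_funpow:
  assumes "x \<in> streams {1..N}" "(lifted_shift F ^^ m) (x, t) \<in> topspace (fractafold_bundle N F)"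
  shows "(x, t) \<in> topspace (fractafold_bundle N F)"
proof -
  obtain n where "word_map F (stake n (sdrop m x)) (word_map F (stake m x) t) \<in> attractor N F"
    using assms(2) by (auto simp: funpow_lifted_shift in_fractafold_bundle_iff funpow_stl)
  then have "word_map F (stake (m + n) x) t \<in> attractor N F"
    by (simp flip: stake_add)
  then show ?thesis using assms(1) by (auto simp: in_fractafold_bundle_iff)
qed

text \<open>In the inductive limit topology openness is tested on each level, where the preimage of
  \<open>U\<close> is the trace of the open set \<open>U \<times> UNIV\<close>.\<close>

lemma continuous_map_fractafold_bundle_fst:
  fixes F :: "nat \<Rightarrow> 'a::metric_space \<Rightarrow> 'a"
  shows "continuous_map (fractafold_bundle N F) (sequence_space N) fst"
  unfolding continuous_map
proof (intro conjI allI impI)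
  show "fst ` topspace (fractafold_bundle N F) \<subseteq> topspace (sequence_space N)"
    by (auto simp: in_fractafold_bundle_iff)
  fix U assume U: "openin (sequence_space N) U"
  let ?P = "{q \<in> topspace (fractafold_bundle N F). fst q \<in> U}"
  have "openin (prod_topology (sequence_space N) (euclidean :: 'a topology)) (U \<times> UNIV)"
    using U by (simp add: openin_prod_Times_iff)
  moreover have "?P \<inter> bundle_level N F n = (U \<times> UNIV) \<inter> bundle_level N F n" for n
    by (auto simp: topspace_fractafold_bundle)
  ultimately have "openin (bundle_level_topology N F n) (?P \<inter> bundle_level N F n)" for n
    unfolding bundle_level_topology_def openin_subtopology by blast
  then show "openin (fractafold_bundle N F) ?P"
    unfolding openin_fractafold_bundle by (auto simp: topspace_fractafold_bundle)
qed

text \<open>Two points over \<open>x\<close> are moved by the same injective map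
  \<open>F (shd x)\<close>, which gives injectivity on fibres. The inverse word map in the canonical
  action is what makes the second coordinates of the iterates agree; the first coordinates agree by
  the shift relation.\<close>

lemma lifted_dynamics_fractafold_bundle:
  fixes F :: "nat \<Rightarrow> 'a::complete_space \<Rightarrow> 'a"
  assumes ifs: "nondegenerate_ifs N F" "\<forall>i\<in>{1..N}. surj (F i)"
  shows "lifted_dynamics (sequence_space N) stl (fractafold_bundle N F) (lifted_shift F) fst
    (canonical_action F)"
proof
  let ?L = "fractafold_bundle N F" and ?\<tau> = "lifted_shift F"
  show "local_homeomorphism (sequence_space N) (sequence_space N) stl"
    by (rule local_homeomorphism_shift)
  show \<tau>: "local_homeomorphism ?L ?L ?\<tau>"
    by (rule local_homeomorphism_lifted_shift[OF ifs])
  show "continuous_map ?L (sequence_space N) fst"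
    by (rule continuous_map_fractafold_bundle_fst)
  show "fst (?\<tau> z) = stl (fst z)" for z :: "nat stream \<times> 'a"
    by (simp add: lifted_shift_def case_prod_unfold)
  show "inj_on ?\<tau> {z \<in> topspace ?L. fst z = x}" for x
  proof (rule inj_onI)
    fix w z assume w: "w \<in> {z \<in> topspace ?L. fst z = x}" and z: "z \<in> {z \<in> topspace ?L. fst z = x}"
      and eq: "?\<tau> w = ?\<tau> z"
    have "x \<in> streams {1..N}"
      using w by (cases w) (auto simp: in_fractafold_bundle_iff)
    then have "inj (F (shd x))" using inj_ifs[OF ifs(1)] streams_shd by blast
    then show "w = z"
      using w z eq by (cases w; cases z) (auto simp: lifted_shift_def dest: injD)
  qed
  fix x z m n
  assume "x \<in> topspace (sequence_space N)" and z: "z \<in> topspace ?L"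
    and eq: "(stl ^^ m) x = (stl ^^ n) (fst z)"
  then have x: "x \<in> streams {1..N}" by simp
  obtain y t where zy: "z = (y, t)" by fastforce
  have y: "y \<in> streams {1..N}" using z by (simp add: zy in_fractafold_bundle_iff)
  define u where "u = inv (word_map F (stake m x)) (word_map F (stake n y) t)"
  have a: "canonical_action F (x, int m - int n, fst z) z = (x, u)"
    using canonical_action_eq[OF ifs x y, of m n t] eq by (simp add: zy u_def)
  have "word_map F (stake m x) u = word_map F (stake n y) t"
    unfolding u_def using bij_word_map[OF ifs stake_in_lists[OF x], of m]
    by (simp add: bij_is_surj surj_f_inv_f)
  then have \<tau>u: "(?\<tau> ^^ m) (x, u) = (?\<tau> ^^ n) z"
    using eq by (simp add: zy funpow_lifted_shift)
  \<comment> \<open>The action value lies in the bundle because its \<open>m\<close>-th iterate is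
    an iterate of \<open>z\<close> and so lies there.\<close>
  then have "(x, u) \<in> topspace ?L"
    using in_fractafold_bundle_if_funpow[OF x] local_homeomorphism_funpow_in_topspace[OF \<tau> z]
    by metis
  then show "canonical_action F (x, int m - int n, fst z) z \<in> topspace ?L \<and>
      fst (canonical_action F (x, int m - int n, fst z) z) = x \<and>
      (?\<tau> ^^ m) (canonical_action F (x, int m - int n, fst z) z) = (?\<tau> ^^ n) z"
    using \<tau>u by (simp add: a)
qed

theorem corollary3p6:
  fixes F :: "nat \<Rightarrow> 'a::complete_space \<Rightarrow> 'a" and N :: nat
  assumes "nondegenerate_ifs N F"
    and "\<And>i. i \<in> {1..N} \<Longrightarrow> surj (F i)"
  shows "topological_groupoid_isomorphic
           (action_groupoid (renault_deaconu (sequence_space N) stl)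
              (fractafold_bundle N F) fst (canonical_action F))
           (renault_deaconu (fractafold_bundle N F) (lifted_shift F))"
  using assms by (intro lifted_dynamics.action_groupoid_isomorphic lifted_dynamics_fractafold_bundle) auto

end
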